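(* Let $\mathcal{H}$ be a Hopf algebra with coproduct $\Delta$ and counit $\varepsilon$, and let $\mathcal{H}^*$ be its dual vector space, regarded as a right $\mathcal{H}_{op}$-module. Then twist elements $\mathcal{F}\in\mathcal{H}\otimes\mathcal{H}$ are in one-to-one correspondence with module algebra structures $\circ$ on $\mathcal{H}^*$ (over $\mathcal{H}_{op}$) such that $\varepsilon\circ f=f\circ\varepsilon=f$ for all $f\in\mathcal{H}^*$. The multiplication corresponding to $\mathcal{F}$ is given by $\langle\alpha\circ\beta,a\rangle=\langle\alpha\otimes\beta,\mathcal{F}\Delta(a)\rangle$ for $\alpha,\beta\in\mathcal{H}^*$, $a\in\mathcal{H}$.
   Context: A twist element of $\mathcal{H}$ is an element $\mathcal{F}\in\mathcal{H}\otimes\mathcal{H}$ satisfying $\mathcal{F}_{12}(\Delta\otimes \mathrm{id})(\mathcal{F})=\mathcal{F}_{23}(\mathrm{id}\otimes\Delta)(\mathcal{F})$, where $\mathcal{F}_{12}=\mathcal{F}\otimes 1$ and $\mathcal{F}_{23}=1\otimes\mathcal{F}$, and $(\varepsilon\otimes \mathrm{id})\mathcal{F}=(\mathrm{id}\otimes\varepsilon)\mathcal{F}=1\otimes 1$ (the ground field being identified with its image in $\mathcal{H}$ in the factor to which $\varepsilon$ is applied). $\langle\cdot,\cdot\rangle$ is the evaluation pairing between $\mathcal{H}^*$ and $\mathcal{H}$, and also between $\mathcal{H}^*\otimes\mathcal{H}^*$ and $\mathcal{H}\otimes\mathcal{H}$. $\mathcal{H}_{op}$ is $\mathcal{H}$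 with the opposite multiplication. $\mathcal{H}^*$ is a right $\mathcal{H}_{op}$-module via $\alpha\mapsto\alpha\tilde b$, where $\langle\alpha\tilde b,a\rangle=\langle\alpha,ab\rangle$ for $a,b\in\mathcal{H}$. A module algebra structure on $\mathcal{H}^*$ over $\mathcal{H}_{op}$ is an associative bilinear multiplication $\circ$ on $\mathcal{H}^*$ such that $(\alpha\circ\beta)\tilde b=\sum(\alpha\tilde b_{(1)})\circ(\beta\tilde b_{(2)})$ for all $\alpha,\beta\in\mathcal{H}^*$, $b\in\mathcal{H}$, where $\Delta(b)=\sum b_{(1)}\otimes b_{(2)}$.
   Formalization: For infinite-dimensional H the correspondence is onto only those module algebra structures whose multiplication on H* is weak-* continuous (without this it fails, e.g. for the rational group algebra of a countable direct sum of Z/2); for finite-dimensional H it is onto all of them. *)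

theory Defs
  imports "HOL-Library.Poly_Mapping" "HOL-Library.FuncSet"
    "HOL-Analysis.Function_Topology" "HOL-Analysis.Product_Topology"
begin

section \<open>Tensor products\<close>

text \<open>
  For a vector space \<open>V\<close> over \<open>'k\<close> (given by \<open>smul\<close> on a type \<open>'a\<close>), the spaces
  \<open>V \<otimes> V\<close> and \<open>V \<otimes> V \<otimes> V\<close> are the usual quotients of the free vector spaces on the set of all
  pairs, respectively triples, of vectors by the span of the multilinearity relations. Since the
  quotient depends on \<open>smul\<close>, it cannot be a type: a tensor is an equivalence class of
  formal sums. Operations on tensors are computed on a chosen representative; the maps extended
  below are all multilinear, so the choice is immaterial (see \<open>lin_ext_class2\<close> and
  \<open>lin_ext_class3\<close>).
\<close>

definition fscale :: "'k::field \<Rightarrow> ('x \<Rightarrow>\<^sub>0 'k) \<Rightarrow> ('x \<Rightarrow>\<^sub>0 'k)" where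
  "fscale c p = Poly_Mapping.map (\<lambda>d. c * d) p"

abbreviation gen :: "'x \<Rightarrow> ('x \<Rightarrow>\<^sub>0 'k::field)" where
  "gen x \<equiv> Poly_Mapping.single x 1"

text \<open>The linear extension to the free vector space on \<open>'x\<close> of a map \<open>f\<close> into the vector space
  with scalar multiplication \<open>s\<close>.\<close>

definition lin_ext :: "('k::field \<Rightarrow> 'v \<Rightarrow> 'v::ab_group_add) \<Rightarrow> ('x \<Rightarrow> 'v) \<Rightarrow> ('x \<Rightarrow>\<^sub>0 'k) \<Rightarrow> 'v" where
  "lin_ext s f p = (\<Sum>x\<in>Poly_Mapping.keys p. s (Poly_Mapping.lookup p x) (f x))"

definition quot_rel :: "('x \<Rightarrow>\<^sub>0 'k::field) set \<Rightarrow> (('x \<Rightarrow>\<^sub>0 'k) \<times> ('x \<Rightarrow>\<^sub>0 'k)) set" where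
  "quot_rel R = {(p, q). p - q \<in> module.span fscale R}"

definition relators2 ::
  "('k::field \<Rightarrow> 'a \<Rightarrow> 'a::ab_group_add) \<Rightarrow> ('a \<times> 'a \<Rightarrow>\<^sub>0 'k) set" where
  "relators2 smul =
     (\<Union>a a' b. {gen (a + a', b) - gen (a, b) - gen (a', b),
                 gen (b, a + a') - gen (b, a) - gen (b, a')}) \<union>
     (\<Union>c a b. {gen (smul c a, b) - fscale c (gen (a, b)),
                gen (a, smul c b) - fscale c (gen (a, b))})"

definition relators3 ::
  "('k::field \<Rightarrow> 'a \<Rightarrow> 'a::ab_group_add) \<Rightarrow> ('a \<times> 'a \<times> 'a \<Rightarrow>\<^sub>0 'k) set" where
  "relators3 smul =
     (\<Union>a a' b c. {gen (a + a', b, c) - gen (a, b, c) - gen (a', b, c),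
                   gen (b, a + a', c) - gen (b, a, c) - gen (b, a', c),
                   gen (b, c, a + a') - gen (b, c, a) - gen (b, c, a')}) \<union>
     (\<Union>r a b c. {gen (smul r a, b, c) - fscale r (gen (a, b, c)),
                  gen (a, smul r b, c) - fscale r (gen (a, b, c)),
                  gen (a, b, smul r c) - fscale r (gen (a, b, c))})"

definition tensor2 ::
  "('k::field \<Rightarrow> 'a \<Rightarrow> 'a::ab_group_add) \<Rightarrow> ('a \<times> 'a \<Rightarrow>\<^sub>0 'k) set set" where
  "tensor2 smul = UNIV // quot_rel (relators2 smul)"

definition class2 ::
  "('k::field \<Rightarrow> 'a \<Rightarrow> 'a::ab_group_add) \<Rightarrow> ('a \<times> 'a \<Rightarrow>\<^sub>0 'k) \<Rightarrow> ('a \<times> 'a \<Rightarrow>\<^sub>0 'k) set" where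
  "class2 smul p = quot_rel (relators2 smul) `` {p}"

definition class3 ::
  "('k::field \<Rightarrow> 'a \<Rightarrow> 'a::ab_group_add) \<Rightarrow>
   ('a \<times> 'a \<times> 'a \<Rightarrow>\<^sub>0 'k) \<Rightarrow> ('a \<times> 'a \<times> 'a \<Rightarrow>\<^sub>0 'k) set" where
  "class3 smul p = quot_rel (relators3 smul) `` {p}"

definition rep :: "('x \<Rightarrow>\<^sub>0 'k::field) set \<Rightarrow> ('x \<Rightarrow>\<^sub>0 'k)" where
  "rep T = (SOME p. p \<in> T)"

lemma lookup_fscale [simp]: "Poly_Mapping.lookup (fscale c p) x = c * Poly_Mapping.lookup p x"
  by (simp add: fscale_def Poly_Mapping.map.rep_eq when_def)

lemma vector_space_fscale: "vector_space (fscale :: 'k::field \<Rightarrow> ('x \<Rightarrow>\<^sub>0 'k) \<Rightarrow> _)"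
  by (unfold_locales; rule poly_mapping_eqI, simp add: lookup_add distrib_left distrib_right mult.assoc)

lemma module_fscale: "module (fscale :: 'k::field \<Rightarrow> ('x \<Rightarrow>\<^sub>0 'k) \<Rightarrow> _)"
  using vector_space_fscale by (simp add: module_iff_vector_space)

lemma equiv_quot_rel: "equiv UNIV (quot_rel (R :: ('x \<Rightarrow>\<^sub>0 'k::field) set))"
proof -
  interpret module "fscale :: 'k \<Rightarrow> ('x \<Rightarrow>\<^sub>0 'k) \<Rightarrow> _" by (rule module_fscale)
  show ?thesis
  proof (rule equivI)
    show "sym (quot_rel R)"
    proof (rule symI)
      fix p q assume "(p, q) \<in> quot_rel R"
      then have "- (p - q) \<in> span R" unfolding quot_rel_def by (intro span_neg) simp
      then show "(q, p) \<in> quot_rel R" by (simp add: quot_rel_def)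
    qed
    show "trans (quot_rel R)"
    proof (rule transI)
      fix p q r assume "(p, q) \<in> quot_rel R" "(q, r) \<in> quot_rel R"
      then have "(p - q) + (q - r) \<in> span R" unfolding quot_rel_def by (intro span_add) simp_all
      then show "(p, r) \<in> quot_rel R" by (simp add: quot_rel_def)
    qed
  qed (auto simp: refl_on_def quot_rel_def span_zero)
qed

lemma lin_ext_superset:
  assumes "vector_space s" "finite A" "Poly_Mapping.keys p \<subseteq> A"
  shows "lin_ext s f p = (\<Sum>x\<in>A. s (Poly_Mapping.lookup p x) (f x))"
proof -
  interpret vector_space s by fact
  show ?thesis unfolding lin_ext_def
    using assms by (intro sum.mono_neutral_left) (auto simp: in_keys_iff)
qed

lemma linear_lin_ext:
  fixes s :: "'k::field \<Rightarrow> 'v \<Rightarrow> 'v::ab_group_add" and f :: "'x \<Rightarrow> 'v"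
  assumes "vector_space s"
  shows "Vector_Spaces.linear fscale s (lin_ext s f)"
proof -
  interpret vector_space s by fact
  show ?thesis
    unfolding module_hom_iff_linear[symmetric]
  proof (intro module_hom.intro module_hom_axioms.intro module_fscale module_axioms)
    fix p q :: "'x \<Rightarrow>\<^sub>0 'k"
    let ?A = "Poly_Mapping.keys p \<union> Poly_Mapping.keys q \<union> Poly_Mapping.keys (p + q)"
    have "lin_ext s f r = (\<Sum>x\<in>?A. s (Poly_Mapping.lookup r x) (f x))" if "r \<in> {p, q, p + q}" for r
      using that by (intro lin_ext_superset[OF assms]) auto
    then show "lin_ext s f (p + q) = lin_ext s f p + lin_ext s f q"
      by (simp add: lookup_add scale_left_distrib sum.distrib)
  next
    fix c and p :: "'x \<Rightarrow>\<^sub>0 'k"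
    let ?A = "Poly_Mapping.keys p \<union> Poly_Mapping.keys (fscale c p)"
    have "lin_ext s f r = (\<Sum>x\<in>?A. s (Poly_Mapping.lookup r x) (f x))" if "r \<in> {p, fscale c p}" for r
      using that by (intro lin_ext_superset[OF assms]) auto
    then show "lin_ext s f (fscale c p) = s c (lin_ext s f p)"
      by (simp add: scale_sum_right)
  qed
qed

lemma lin_ext_gen:
  assumes "vector_space s"
  shows "lin_ext s f (gen x) = f x"
proof -
  interpret vector_space s by fact
  show ?thesis by (simp add: lin_ext_def)
qed

lemma lin_ext_diff:
  assumes "vector_space s"
  shows "lin_ext s f (p - q) = lin_ext s f p - lin_ext s f q"
  using linear_lin_ext[OF assms] unfolding module_hom_iff_linear[symmetric]
  by (rule module_hom.diff)

lemma lin_ext_fscale: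
  assumes "vector_space s"
  shows "lin_ext s f (fscale c p) = s c (lin_ext s f p)"
  using linear_lin_ext[OF assms] unfolding module_hom_iff_linear[symmetric]
  by (rule module_hom.scale)

lemma lin_ext_quot_rel:
  assumes s: "vector_space s" and R: "\<And>r. r \<in> R \<Longrightarrow> lin_ext s f r = 0"
    and pq: "(p, q) \<in> quot_rel R"
  shows "lin_ext s f p = lin_ext s f q"
proof -
  have "p - q \<in> module.span fscale R"
    using pq by (simp add: quot_rel_def)
  then have "lin_ext s f (p - q) = 0"
    using linear_lin_ext[OF s] R unfolding module_hom_iff_linear[symmetric]
    by (rule module_hom.eq_0_on_span[rotated 2])
  then show ?thesis by (simp only: lin_ext_diff[OF s] right_minus_eq)
qed

lemma rep_class: "(p, rep (quot_rel R `` {p})) \<in> quot_rel R"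
proof -
  have "p \<in> quot_rel R `` {p}"
    by (rule equiv_class_self[OF equiv_quot_rel UNIV_I])
  then have "rep (quot_rel R `` {p}) \<in> quot_rel R `` {p}"
    unfolding rep_def by (rule someI)
  then show ?thesis by (simp only: Image_singleton_iff)
qed

lemma lin_ext_relator:
  assumes s: "vector_space s"
  shows "f x = f y + f z \<Longrightarrow> lin_ext s f (gen x - gen y - gen z) = 0"
    and "f x = s c (f y) \<Longrightarrow> lin_ext s f (gen x - fscale c (gen y)) = 0"
  by (simp_all only: lin_ext_diff[OF s] lin_ext_fscale[OF s] lin_ext_gen[OF s]
      add_diff_cancel_left' diff_self)

lemma lin_ext_class2:
  assumes s: "vector_space s"
    and 1: "\<And>b. Vector_Spaces.linear smul s (\<lambda>a. f (a, b))"
    and 2: "\<And>a. Vector_Spaces.linear smul s (\<lambda>b. f (a, b))"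
  shows "lin_ext s f (rep (class2 smul p)) = lin_ext s f p"
proof (rule lin_ext_quot_rel[OF s, symmetric, where R = "relators2 smul"])
  note hom = 1[folded module_hom_iff_linear] 2[folded module_hom_iff_linear]
  fix r assume "r \<in> relators2 smul"
  then show "lin_ext s f r = 0"
    unfolding relators2_def
    by (elim UnE UN_E insertE emptyE; hypsubst)
      (rule lin_ext_relator[OF s], rule hom[THEN module_hom.add] hom[THEN module_hom.scale])+
qed (unfold class2_def, rule rep_class)

lemma lin_ext_class3:
  assumes s: "vector_space s"
    and 1: "\<And>b c. Vector_Spaces.linear smul s (\<lambda>a. f (a, b, c))"
    and 2: "\<And>a c. Vector_Spaces.linear smul s (\<lambda>b. f (a, b, c))"
    and 3: "\<And>a b. Vector_Spaces.linear smul s (\<lambda>c. f (a, b, c))"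
  shows "lin_ext s f (rep (class3 smul p)) = lin_ext s f p"
proof (rule lin_ext_quot_rel[OF s, symmetric, where R = "relators3 smul"])
  note hom = 1[folded module_hom_iff_linear] 2[folded module_hom_iff_linear]
    3[folded module_hom_iff_linear]
  fix r assume "r \<in> relators3 smul"
  then show "lin_ext s f r = 0"
    unfolding relators3_def
    by (elim UnE UN_E insertE emptyE; hypsubst)
      (rule lin_ext_relator[OF s], rule hom[THEN module_hom.add] hom[THEN module_hom.scale])+
qed (unfold class3_def, rule rep_class)


section \<open>Operations on tensors\<close>

text \<open>The products of the algebras \<open>H \<otimes> H\<close> and \<open>H \<otimes> H \<otimes> H\<close>.\<close>

definition mult2 :: "('k::field \<Rightarrow> 'a \<Rightarrow> 'a::ring_1) \<Rightarrow>
    ('a \<times> 'a \<Rightarrow>\<^sub>0 'k) set \<Rightarrow> ('a \<times> 'a \<Rightarrow>\<^sub>0 'k) set \<Rightarrow> ('a \<times> 'a \<Rightarrow>\<^sub>0 'k) set" where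
  "mult2 smul S T = class2 smul
     (lin_ext fscale (\<lambda>(a, b). lin_ext fscale (\<lambda>(a', b'). gen (a * a', b * b')) (rep T)) (rep S))"

definition mult3 :: "('k::field \<Rightarrow> 'a \<Rightarrow> 'a::ring_1) \<Rightarrow>
    ('a \<times> 'a \<times> 'a \<Rightarrow>\<^sub>0 'k) set \<Rightarrow> ('a \<times> 'a \<times> 'a \<Rightarrow>\<^sub>0 'k) set \<Rightarrow> ('a \<times> 'a \<times> 'a \<Rightarrow>\<^sub>0 'k) set" where
  "mult3 smul S T = class3 smul
     (lin_ext fscale (\<lambda>(a, b, c).
        lin_ext fscale (\<lambda>(a', b', c'). gen (a * a', b * b', c * c')) (rep T)) (rep S))"

text \<open>\<open>T\<^sub>1\<^sub>2 = T \<otimes> 1\<close> and \<open>T\<^sub>2\<^sub>3 = 1 \<otimes> T\<close>.\<close>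

definition leg12 :: "('k::field \<Rightarrow> 'a \<Rightarrow> 'a::ring_1) \<Rightarrow>
    ('a \<times> 'a \<Rightarrow>\<^sub>0 'k) set \<Rightarrow> ('a \<times> 'a \<times> 'a \<Rightarrow>\<^sub>0 'k) set" where
  "leg12 smul T = class3 smul (lin_ext fscale (\<lambda>(a, b). gen (a, b, 1)) (rep T))"

definition leg23 :: "('k::field \<Rightarrow> 'a \<Rightarrow> 'a::ring_1) \<Rightarrow>
    ('a \<times> 'a \<Rightarrow>\<^sub>0 'k) set \<Rightarrow> ('a \<times> 'a \<times> 'a \<Rightarrow>\<^sub>0 'k) set" where
  "leg23 smul T = class3 smul (lin_ext fscale (\<lambda>(a, b). gen (1, a, b)) (rep T))"

text \<open>\<open>\<Delta> \<otimes> id\<close> and \<open>id \<otimes> \<Delta>\<close>, as maps from \<open>H \<otimes> H\<close> to \<open>H \<otimes> H \<otimes> H\<close>.\<close>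

definition cop_id :: "('k::field \<Rightarrow> 'a \<Rightarrow> 'a::ring_1) \<Rightarrow> ('a \<Rightarrow> ('a \<times> 'a \<Rightarrow>\<^sub>0 'k) set) \<Rightarrow>
    ('a \<times> 'a \<Rightarrow>\<^sub>0 'k) set \<Rightarrow> ('a \<times> 'a \<times> 'a \<Rightarrow>\<^sub>0 'k) set" where
  "cop_id smul \<Delta> T = class3 smul
     (lin_ext fscale (\<lambda>(a, b). lin_ext fscale (\<lambda>(u, v). gen (u, v, b)) (rep (\<Delta> a))) (rep T))"

definition id_cop :: "('k::field \<Rightarrow> 'a \<Rightarrow> 'a::ring_1) \<Rightarrow> ('a \<Rightarrow> ('a \<times> 'a \<Rightarrow>\<^sub>0 'k) set) \<Rightarrow>
    ('a \<times> 'a \<Rightarrow>\<^sub>0 'k) set \<Rightarrow> ('a \<times> 'a \<times> 'a \<Rightarrow>\<^sub>0 'k) set" where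
  "id_cop smul \<Delta> T = class3 smul
     (lin_ext fscale (\<lambda>(a, b). lin_ext fscale (\<lambda>(u, v). gen (a, u, v)) (rep (\<Delta> b))) (rep T))"

text \<open>\<open>\<epsilon> \<otimes> id\<close> and \<open>id \<otimes> \<epsilon>\<close> as endomaps of \<open>H \<otimes> H\<close>, a scalar \<open>c\<close> being identified with
  \<open>c 1 \<in> H\<close>.\<close>

definition eps_id :: "('k::field \<Rightarrow> 'a \<Rightarrow> 'a::ring_1) \<Rightarrow> ('a \<Rightarrow> 'k) \<Rightarrow>
    ('a \<times> 'a \<Rightarrow>\<^sub>0 'k) set \<Rightarrow> ('a \<times> 'a \<Rightarrow>\<^sub>0 'k) set" where
  "eps_id smul \<epsilon> T = class2 smul (lin_ext fscale (\<lambda>(a, b). gen (smul (\<epsilon> a) 1, b)) (rep T))"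

definition id_eps :: "('k::field \<Rightarrow> 'a \<Rightarrow> 'a::ring_1) \<Rightarrow> ('a \<Rightarrow> 'k) \<Rightarrow>
    ('a \<times> 'a \<Rightarrow>\<^sub>0 'k) set \<Rightarrow> ('a \<times> 'a \<Rightarrow>\<^sub>0 'k) set" where
  "id_eps smul \<epsilon> T = class2 smul (lin_ext fscale (\<lambda>(a, b). gen (a, smul (\<epsilon> b) 1)) (rep T))"

text \<open>\<open>\<langle>\<alpha> \<otimes> \<beta>, T\<rangle>\<close>\<close>

definition pair2 :: "('a \<Rightarrow> 'k::field) \<Rightarrow> ('a \<Rightarrow> 'k) \<Rightarrow> ('a \<times> 'a \<Rightarrow>\<^sub>0 'k) set \<Rightarrow> 'k" where
  "pair2 \<alpha> \<beta> T = lin_ext (*) (\<lambda>(a, b). \<alpha> a * \<beta> b) (rep T)"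


section \<open>Hopf algebras and twists\<close>

locale hopf_algebra = vector_space smul
  for smul :: "'k::field \<Rightarrow> 'a::ring_1 \<Rightarrow> 'a" (infixr \<open>*s\<close> 75) +
  fixes \<Delta> :: "'a \<Rightarrow> ('a \<times> 'a \<Rightarrow>\<^sub>0 'k) set"
    and \<epsilon> :: "'a \<Rightarrow> 'k"
    and S :: "'a \<Rightarrow> 'a"
  assumes scale_mult_left: "(c *s a) * b = c *s (a * b)"
    and scale_mult_right: "a * (c *s b) = c *s (a * b)"
    and cop_tensor: "\<Delta> a \<in> tensor2 smul"
    and cop_add: "\<Delta> (a + b) = class2 smul (rep (\<Delta> a) + rep (\<Delta> b))"
    and cop_scale: "\<Delta> (c *s a) = class2 smul (fscale c (rep (\<Delta> a)))"
    and cop_one: "\<Delta> 1 = class2 smul (gen (1, 1))"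
    and cop_mult: "\<Delta> (a * b) = mult2 smul (\<Delta> a) (\<Delta> b)"
    and coassoc: "cop_id smul \<Delta> (\<Delta> a) = id_cop smul \<Delta> (\<Delta> a)"
    and counit_linear: "Vector_Spaces.linear smul (*) \<epsilon>"
    and counit_one: "\<epsilon> 1 = 1"
    and counit_mult: "\<epsilon> (a * b) = \<epsilon> a * \<epsilon> b"
    and counit_left: "lin_ext smul (\<lambda>(x, y). \<epsilon> x *s y) (rep (\<Delta> a)) = a"
    and counit_right: "lin_ext smul (\<lambda>(x, y). \<epsilon> y *s x) (rep (\<Delta> a)) = a"
    and antipode_linear: "Vector_Spaces.linear smul smul S"
    and antipode_left: "lin_ext smul (\<lambda>(x, y). S x * y) (rep (\<Delta> a)) = \<epsilon> a *s 1"
    and antipode_right: "lin_ext smul (\<lambda>(x, y). x * S y) (rep (\<Delta> a)) = \<epsilon> a *s 1"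

definition twist_element :: "('k::field \<Rightarrow> 'a \<Rightarrow> 'a::ring_1) \<Rightarrow>
    ('a \<Rightarrow> ('a \<times> 'a \<Rightarrow>\<^sub>0 'k) set) \<Rightarrow> ('a \<Rightarrow> 'k) \<Rightarrow> ('a \<times> 'a \<Rightarrow>\<^sub>0 'k) set \<Rightarrow> bool" where
  "twist_element smul \<Delta> \<epsilon> F \<longleftrightarrow>
     F \<in> tensor2 smul \<and>
     mult3 smul (leg12 smul F) (cop_id smul \<Delta> F) =
       mult3 smul (leg23 smul F) (id_cop smul \<Delta> F) \<and>
     eps_id smul \<epsilon> F = class2 smul (gen (1, 1)) \<and>
     id_eps smul \<epsilon> F = class2 smul (gen (1, 1))"


section \<open>Module algebra structures on the dual space\<close>

definition dual :: "('k::field \<Rightarrow> 'a \<Rightarrow> 'a::ab_group_add) \<Rightarrow> ('a \<Rightarrow> 'k) set" where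
  "dual smul = {\<alpha>. Vector_Spaces.linear smul (*) \<alpha>}"

text \<open>The right action of the opposite algebra of \<open>H\<close>: \<open>\<langle>\<alpha>\<tilde>b, a\<rangle> = \<langle>\<alpha>, a b\<rangle>\<close>.\<close>

definition act :: "('a::ring_1 \<Rightarrow> 'k::field) \<Rightarrow> 'a \<Rightarrow> ('a \<Rightarrow> 'k)" where
  "act \<alpha> b = (\<lambda>a. \<alpha> (a * b))"

text \<open>A multiplication on the dual space is required to be \<^const>\<open>extensional\<close> (undefined
  outside of the dual space), so that equality of such functions is equality of multiplications.\<close>

definition module_algebra :: "('k::field \<Rightarrow> 'a \<Rightarrow> 'a::ring_1) \<Rightarrow>
    ('a \<Rightarrow> ('a \<times> 'a \<Rightarrow>\<^sub>0 'k) set) \<Rightarrow> (('a \<Rightarrow> 'k) \<Rightarrow> ('a \<Rightarrow> 'k) \<Rightarrow> ('a \<Rightarrow> 'k)) \<Rightarrow> bool" where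
  "module_algebra smul \<Delta> m \<longleftrightarrow>
     m \<in> dual smul \<rightarrow>\<^sub>E (dual smul \<rightarrow>\<^sub>E dual smul) \<and>
     (\<forall>\<alpha>\<in>dual smul. \<forall>\<beta>\<in>dual smul. \<forall>\<gamma>\<in>dual smul. \<forall>c a.
        m (\<lambda>x. \<alpha> x + \<beta> x) \<gamma> a = m \<alpha> \<gamma> a + m \<beta> \<gamma> a \<and>
        m \<gamma> (\<lambda>x. \<alpha> x + \<beta> x) a = m \<gamma> \<alpha> a + m \<gamma> \<beta> a \<and>
        m (\<lambda>x. c * \<alpha> x) \<gamma> a = c * m \<alpha> \<gamma> a \<and>
        m \<gamma> (\<lambda>x. c * \<alpha> x) a = c * m \<gamma> \<alpha> a) \<and>
     (\<forall>\<alpha>\<in>dual smul. \<forall>\<beta>\<in>dual smul. \<forall>\<gamma>\<in>dual smul. m (m \<alpha> \<beta>) \<gamma> = m \<alpha> (m \<beta> \<gamma>)) \<and>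
     (\<forall>\<alpha>\<in>dual smul. \<forall>\<beta>\<in>dual smul. \<forall>b a.
        act (m \<alpha> \<beta>) b a =
          lin_ext (*) (\<lambda>(b\<^sub>1, b\<^sub>2). m (act \<alpha> b\<^sub>1) (act \<beta> b\<^sub>2) a) (rep (\<Delta> b)))"

definition unital_module_algebra :: "('k::field \<Rightarrow> 'a \<Rightarrow> 'a::ring_1) \<Rightarrow>
    ('a \<Rightarrow> ('a \<times> 'a \<Rightarrow>\<^sub>0 'k) set) \<Rightarrow> ('a \<Rightarrow> 'k) \<Rightarrow>
    (('a \<Rightarrow> 'k) \<Rightarrow> ('a \<Rightarrow> 'k) \<Rightarrow> ('a \<Rightarrow> 'k)) \<Rightarrow> bool" where
  "unital_module_algebra smul \<Delta> \<epsilon> m \<longleftrightarrow>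
     module_algebra smul \<Delta> m \<and> (\<forall>f\<in>dual smul. m \<epsilon> f = f \<and> m f \<epsilon> = f)"

text \<open>The weak-* topology of the dual space: pointwise convergence, with the discrete topology on
  the ground field. If \<open>H\<close> is finite-dimensional, this is the discrete topology and every bilinear
  multiplication is continuous. If \<open>H\<close> is infinite-dimensional, the functional
  \<open>\<alpha> \<otimes> \<beta> \<mapsto> \<langle>\<alpha> \<circ> \<beta>, 1\<rangle>\<close> of a discontinuous module algebra structure is not given by any element of
  \<open>H \<otimes> H\<close>.\<close>

definition weak_star :: "('k::field \<Rightarrow> 'a \<Rightarrow> 'a::ab_group_add) \<Rightarrow> ('a \<Rightarrow> 'k) topology" where
  "weak_star smul =
     subtopology (product_topology (\<lambda>_. discrete_topology UNIV) UNIV) (dual smul)"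

end

(* Tensors in H (x) H and H (x) H (x) H are separated by pairs and triples of functionals: a
   multilinear form agrees, on any finite set of vectors, with a finite sum of products of
   functionals. An equivariant bilinear multiplication on the dual is determined by the bilinear
   form <al o be, 1>, because <al o be, a> = sum <al~a_1 o be~a_2, 1>. For the multiplication
   defined by F this form is the pairing with F, so F is determined by its multiplication;
   associativity at 1 is the pairing of the twist equation with al (x) be (x) ga, and coassociativity
   extends associativity from 1 to all of H; likewise for the units, with the counit axioms.
   Conversely, weak-* continuity makes the form depend on the values of al and be at finitely many
   vectors only, which is what it takes to be the pairing with an element of H (x) H. *)

theory Submission
  imports Defs
begin

section \<open>Linear extensions with values in the ground field\<close>

text \<open>A tensor is a class with an arbitrarily chosen representative, so identities of tensors
  are tested by multilinear forms, on which the choice has no effect; \<open>ev\<close> is the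
  summation over a representative, that is, a Sweedler sum. Associativity and units can be compared
  with the twist conditions one at a time because the multiplication attached to a tensor F is
  bilinear and equivariant for every F. The obstacle is the passage from continuity to an element of
  H (x) H. Continuity at (0, 0) controls the form only on pairs whose two members both vanish on a
  finite set K; the product of one coordinate of \<alpha> with a discontinuous functional of \<beta>
  would still pass this test. Continuity at (0, d) and (d, 0), for the finitely many coordinate
  functionals d attached to K, closes the gap.\<close>

lemma vector_space_mult: "vector_space ((*) :: 'k::field \<Rightarrow> 'k \<Rightarrow> 'k)"
  by unfold_locales (simp_all add: algebra_simps)

abbreviation ev :: "('x \<Rightarrow> 'k::field) \<Rightarrow> ('x \<Rightarrow>\<^sub>0 'k) \<Rightarrow> 'k" where
  "ev \<equiv> lin_ext (*)"

lemmas ev_gen [simp] = lin_ext_gen[OF vector_space_mult]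
  and ev_diff = lin_ext_diff[OF vector_space_mult]
  and ev_fscale = lin_ext_fscale[OF vector_space_mult]

lemma ev_add: "ev f (p + q) = ev f p + ev f q"
  using linear_lin_ext[OF vector_space_mult, of f]
  by (simp add: Vector_Spaces.linear_iff)

lemma linear_lin_ext_apply:
  assumes "vector_space s" and g: "Vector_Spaces.linear s s' g"
  shows "g (lin_ext s f p) = lin_ext s' (\<lambda>x. g (f x)) p"
  using g unfolding lin_ext_def module_hom_iff_linear[symmetric]
  by (simp add: module_hom.sum module_hom.scale)

lemma ev_lin_ext: "ev f (lin_ext fscale g p) = ev (\<lambda>x. ev f (g x)) p"
  by (rule linear_lin_ext_apply[OF vector_space_fscale linear_lin_ext[OF vector_space_mult]])

lemma ev_swap: "ev (\<lambda>x. ev (\<lambda>y. h x y) q) p = ev (\<lambda>y. ev (\<lambda>x. h x y) p) q"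
  unfolding lin_ext_def sum_distrib_left by (subst sum.swap) (simp add: mult.left_commute)

lemma ev_plus_fun: "ev (\<lambda>x. f x + g x) p = ev f p + ev g p"
  by (simp add: lin_ext_def distrib_left sum.distrib)

lemma ev_mult_left: "ev (\<lambda>x. c * f x) p = c * ev f p"
  by (simp add: lin_ext_def sum_distrib_left mult.left_commute)

lemma ev_mult_right: "ev (\<lambda>x. f x * c) p = ev f p * c"
  by (simp add: lin_ext_def sum_distrib_right mult.assoc)

lemma ev_zero [simp]: "ev (\<lambda>x. 0) p = 0"
  by (simp add: lin_ext_def)

lemma ev_sum: "ev (\<lambda>x. \<Sum>i\<in>I. f i x) p = (\<Sum>i\<in>I. ev (f i) p)"
  by (induction I rule: infinite_finite_induct) (simp_all add: ev_plus_fun)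

lemma ev_single: "ev f (Poly_Mapping.single x c) = c * f x"
  by (simp add: lin_ext_def)

lemma ev_sum_arg: "ev f (\<Sum>i\<in>I. p i) = (\<Sum>i\<in>I. ev f (p i))"
  by (induction I rule: infinite_finite_induct) (simp_all add: ev_add, simp_all add: lin_ext_def)

text \<open>A functional on the free vector space is the same datum as a function on the generators.
  Through this a functional that kills the relators becomes a multilinear form.\<close>

lemma ev_linear_functional:
  assumes "Vector_Spaces.linear fscale (*) \<phi>"
  shows "\<phi> p = ev (\<lambda>x. \<phi> (gen x)) p"
proof -
  have "p = lin_ext fscale gen p"
    by (rule poly_mapping_eqI)
      (simp add: lin_ext_def lookup_sum lookup_single when_def in_keys_iff
        if_distrib[of "(*) _"] cong: if_cong)
  then show ?thesis
    by (metis linear_lin_ext_apply[OF vector_space_fscale assms])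
qed

text \<open>A basis of \<open>span R\<close> stays independent when p is added, so a functional can
  be prescribed as 1 at p and 0 on that basis. It will detect inequality in a quotient by
  relators.\<close>

lemma (in vector_space) exists_separating_functional:
  assumes "p \<notin> span R"
  shows "\<exists>\<phi>. Vector_Spaces.linear scale (*) \<phi> \<and> (\<forall>r\<in>span R. \<phi> r = 0) \<and> \<phi> p \<noteq> 0"
proof -
  interpret K: vector_space "(*) :: 'a \<Rightarrow> 'a \<Rightarrow> 'a" by (rule vector_space_mult)
  interpret P: vector_space_pair scale "(*) :: 'a \<Rightarrow> 'a \<Rightarrow> 'a" ..
  obtain B where B: "B \<subseteq> span R" "independent B" "span R \<subseteq> span B"
    using basis_exists[of "span R"] by metis
  have p: "p \<notin> span B"
    using assms B(1) span_mono span_span by blast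
  obtain \<phi> where \<phi>: "Vector_Spaces.linear scale (*) \<phi>"
      "\<forall>x\<in>insert p B. \<phi> x = (if x = p then 1 else 0)"
    using P.linear_independent_extend[OF independent_insertI[OF p B(2)],
        of "\<lambda>x. if x = p then 1 else 0"] by blast
  have "\<phi> r = 0" if "r \<in> span R" for r
    using module_hom.eq_0_on_span[OF \<phi>(1)[folded module_hom_iff_linear], of B r] \<phi>(2) p B(3) that
    by (metis insertCI span_base subsetD)
  with \<phi> show ?thesis by auto
qed

section \<open>Functionals separate tensors\<close>

lemma (in vector_space) dual_iff:
  "\<alpha> \<in> dual scale \<longleftrightarrow> (\<forall>x y. \<alpha> (x + y) = \<alpha> x + \<alpha> y) \<and> (\<forall>c x. \<alpha> (c *s x) = c * \<alpha> x)"
  by (simp add: dual_def Vector_Spaces.linear_iff vector_space_mult vector_space_axioms)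

lemma (in vector_space) dual_sum:
  assumes "\<alpha> \<in> dual scale"
  shows "\<alpha> (\<Sum>i\<in>I. c i *s x i) = (\<Sum>i\<in>I. c i * \<alpha> (x i))"
  using assms unfolding dual_def module_hom_iff_linear[symmetric]
  by (simp add: module_hom.sum module_hom.scale)

lemma (in vector_space) dual_lincomb:
  assumes "\<And>i. i \<in> I \<Longrightarrow> d i \<in> dual scale"
  shows "(\<lambda>x. \<Sum>i\<in>I. c i * d i x) \<in> dual scale"
  using assms by (simp add: dual_iff sum.distrib distrib_left sum_distrib_left mult.left_commute)

lemma (in vector_space) dual_zero: "(\<lambda>x. 0) \<in> dual scale"
  by (simp add: dual_iff)

lemma (in vector_space) dual_ev:
  "(\<And>x. (\<lambda>a. f a x) \<in> dual scale) \<Longrightarrow> (\<lambda>a. ev (f a) p) \<in> dual scale"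
  by (auto simp: dual_iff intro!: arg_cong[where f = "\<lambda>g. ev g p"] simp flip: ev_plus_fun ev_mult_left)

text \<open>The coordinate functionals come from a basis of the whole space, so they are linear
  everywhere; only finitely many of them are nonzero somewhere on the finite set K, and E collects
  their basis vectors.\<close>

lemma (in vector_space) finite_dual_basis:
  assumes "finite K"
  shows "\<exists>E d. finite E \<and> (\<forall>e\<in>E. d e \<in> dual scale) \<and> (\<forall>x\<in>K. x = (\<Sum>e\<in>E. d e x *s e))"
proof -
  define B where "B = extend_basis {}"
  have B: "independent B" "span B = UNIV"
    by (auto simp: B_def independent_extend_basis independent_empty)
  let ?d = "\<lambda>e x. representation B x e"
  define E where "E = (\<Union>x\<in>K. {e. ?d e x \<noteq> 0})"
  have E: "finite E"
    using assms by (auto simp: E_def finite_representation)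
  have "(\<Sum>e\<in>E. ?d e x *s e) = x" if "x \<in> K" for x
  proof -
    have "(\<Sum>e\<in>E. ?d e x *s e) = (\<Sum>e | ?d e x \<noteq> 0. ?d e x *s e)"
      using that E by (intro sum.mono_neutral_right) (auto simp: E_def)
    also have "\<dots> = x"
      using B by (simp add: sum_nonzero_representation_eq)
    finally show ?thesis .
  qed
  moreover have "?d e \<in> dual scale" for e
    using B by (simp add: dual_iff representation_add representation_scale)
  ultimately show ?thesis
    using E by (intro exI[of _ E] exI[of _ ?d]) auto
qed

lemma (in vector_space) dual_remainder:
  assumes "\<alpha> \<in> dual scale" "\<forall>e\<in>E. d e \<in> dual scale"
  shows "(\<lambda>x. \<alpha> x - (\<Sum>e\<in>E. \<alpha> e * d e x)) \<in> dual scale"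
  using assms(1) dual_lincomb[of E d \<alpha>] assms(2) by (simp add: dual_iff algebra_simps)

text \<open>The subtracted sum interpolates \<alpha> on K. Subtracting it is how an arbitrary
  functional is made to vanish on a finite set, at the price of finitely many correction
  terms.\<close>

lemma (in vector_space) remainder_eq_0:
  assumes "\<alpha> \<in> dual scale" "\<forall>x\<in>K. x = (\<Sum>e\<in>E. d e x *s e)" "x \<in> K"
  shows "\<alpha> x - (\<Sum>e\<in>E. \<alpha> e * d e x) = 0"
proof -
  have "\<alpha> x = \<alpha> (\<Sum>e\<in>E. d e x *s e)"
    by (rule arg_cong[where f = \<alpha>, OF bspec[OF assms(2,3)]])
  then show ?thesis
    unfolding dual_sum[OF assms(1)] by (simp add: mult.commute)
qed

text \<open>The argument is a pair because pairs generate the free vector space. Bilinearity says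
  exactly that the linear extension kills \<open>relators2\<close>, so that its value on a tensor is
  independent of the representative.\<close>

definition (in vector_space) bilin :: "('b \<times> 'b \<Rightarrow> 'a) \<Rightarrow> bool" where
  "bilin f \<longleftrightarrow> (\<forall>b. (\<lambda>a. f (a, b)) \<in> dual scale) \<and> (\<forall>a. (\<lambda>b. f (a, b)) \<in> dual scale)"

definition (in vector_space) trilin :: "('b \<times> 'b \<times> 'b \<Rightarrow> 'a) \<Rightarrow> bool" where
  "trilin f \<longleftrightarrow> (\<forall>b c. (\<lambda>a. f (a, b, c)) \<in> dual scale) \<and> (\<forall>a c. (\<lambda>b. f (a, b, c)) \<in> dual scale) \<and>
     (\<forall>a b. (\<lambda>c. f (a, b, c)) \<in> dual scale)"

context vector_space
begin

lemma ev_class2: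
  assumes "bilin f"
  shows "ev f (rep (class2 scale p)) = ev f p"
  using assms by (intro lin_ext_class2[OF vector_space_mult]) (auto simp: bilin_def dual_def)

lemma ev_class3:
  assumes "trilin f"
  shows "ev f (rep (class3 scale p)) = ev f p"
  using assms by (intro lin_ext_class3[OF vector_space_mult]) (auto simp: trilin_def dual_def)

lemma bilin_tensor: "\<lbrakk>\<alpha> \<in> dual scale; \<beta> \<in> dual scale\<rbrakk> \<Longrightarrow> bilin (\<lambda>(a, b). \<alpha> a * \<beta> b)"
  by (auto simp: bilin_def dual_iff algebra_simps)

lemma trilin_tensor:
  "\<lbrakk>\<alpha> \<in> dual scale; \<beta> \<in> dual scale; \<gamma> \<in> dual scale\<rbrakk> \<Longrightarrow> trilin (\<lambda>(a, b, c). \<alpha> a * \<beta> b * \<gamma> c)"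
  by (auto simp: trilin_def dual_iff algebra_simps)

text \<open>In infinite dimension f need not be a finite sum of products of functionals. Only its
  values at the vectors occurring in p matter, and there a finite dual basis expands it, with the
  numbers \<open>f (e, e')\<close> as coefficients.\<close>

lemma bilin_ev_eq_0:
  assumes f: "bilin f"
    and 0: "\<And>\<alpha> \<beta>. \<lbrakk>\<alpha> \<in> dual scale; \<beta> \<in> dual scale\<rbrakk> \<Longrightarrow> ev (\<lambda>(a, b). \<alpha> a * \<beta> b) p = 0"
  shows "ev f p = 0"
proof -
  define K where "K = fst ` Poly_Mapping.keys p \<union> snd ` Poly_Mapping.keys p"
  have "finite K" by (simp add: K_def)
  obtain E d where E: "finite E" "\<forall>e\<in>E. d e \<in> dual scale"
    and d: "\<forall>x\<in>K. x = (\<Sum>e\<in>E. d e x *s e)"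
    using finite_dual_basis[OF \<open>finite K\<close>] by (elim exE conjE)
  have f': "f (a, b) = (\<Sum>e\<in>E. \<Sum>e'\<in>E. f (e, e') * (d e a * d e' b))" if "a \<in> K" "b \<in> K" for a b
  proof -
    have 1: "f (\<Sum>e\<in>E. d e a *s e, y) = (\<Sum>e\<in>E. d e a * f (e, y))" for y
      using dual_sum[of "\<lambda>x. f (x, y)" "\<lambda>e. d e a" "\<lambda>e. e" E] f by (simp add: bilin_def)
    have 2: "f (x, \<Sum>e\<in>E. d e b *s e) = (\<Sum>e\<in>E. d e b * f (x, e))" for x
      using dual_sum[of "\<lambda>y. f (x, y)" "\<lambda>e. d e b" "\<lambda>e. e" E] f by (simp add: bilin_def)
    have "f (a, b) = f (\<Sum>e\<in>E. d e a *s e, \<Sum>e\<in>E. d e b *s e)"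
      using d[THEN bspec, symmetric] that by simp
    also have "\<dots> = (\<Sum>e\<in>E. d e a * (\<Sum>e'\<in>E. d e' b * f (e, e')))"
      unfolding 1 unfolding 2 ..
    finally show ?thesis by (simp add: sum_distrib_left mult_ac)
  qed
  have "ev f p = ev (\<lambda>(a, b). \<Sum>e\<in>E. \<Sum>e'\<in>E. f (e, e') * (d e a * d e' b)) p"
    unfolding lin_ext_def by (rule sum.cong[OF refl]) (force simp: K_def intro!: f')
  also have "\<dots> = (\<Sum>e\<in>E. \<Sum>e'\<in>E. f (e, e') * ev (\<lambda>(a, b). d e a * d e' b) p)"
    by (simp add: case_prod_unfold ev_sum ev_mult_left)
  finally show ?thesis using 0 E by simp
qed

lemma trilin_ev_eq_0:
  assumes f: "trilin f"
    and 0: "\<And>\<alpha> \<beta> \<gamma>. \<lbrakk>\<alpha> \<in> dual scale; \<beta> \<in> dual scale; \<gamma> \<in> dual scale\<rbrakk>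
      \<Longrightarrow> ev (\<lambda>(a, b, c). \<alpha> a * \<beta> b * \<gamma> c) p = 0"
  shows "ev f p = 0"
proof -
  define K where "K = fst ` Poly_Mapping.keys p \<union> (fst \<circ> snd) ` Poly_Mapping.keys p
    \<union> (snd \<circ> snd) ` Poly_Mapping.keys p"
  have "finite K" by (simp add: K_def)
  obtain E d where E: "finite E" "\<forall>e\<in>E. d e \<in> dual scale"
    and d: "\<forall>x\<in>K. x = (\<Sum>e\<in>E. d e x *s e)"
    using finite_dual_basis[OF \<open>finite K\<close>] by (elim exE conjE)
  have f': "f (a, b, c) = (\<Sum>e\<in>E. \<Sum>e'\<in>E. \<Sum>e''\<in>E. f (e, e', e'') * (d e a * d e' b * d e'' c))"
    if "a \<in> K" "b \<in> K" "c \<in> K" for a b c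
  proof -
    have 1: "f (\<Sum>e\<in>E. d e a *s e, y, z) = (\<Sum>e\<in>E. d e a * f (e, y, z))" for y z
      using dual_sum[of "\<lambda>x. f (x, y, z)" "\<lambda>e. d e a" "\<lambda>e. e" E] f by (simp add: trilin_def)
    have 2: "f (x, \<Sum>e\<in>E. d e b *s e, z) = (\<Sum>e\<in>E. d e b * f (x, e, z))" for x z
      using dual_sum[of "\<lambda>y. f (x, y, z)" "\<lambda>e. d e b" "\<lambda>e. e" E] f by (simp add: trilin_def)
    have 3: "f (x, y, \<Sum>e\<in>E. d e c *s e) = (\<Sum>e\<in>E. d e c * f (x, y, e))" for x y
      using dual_sum[of "\<lambda>z. f (x, y, z)" "\<lambda>e. d e c" "\<lambda>e. e" E] f by (simp add: trilin_def)
    have "f (a, b, c) = f (\<Sum>e\<in>E. d e a *s e, \<Sum>e\<in>E. d e b *s e, \<Sum>e\<in>E. d e c *s e)"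
      using d[THEN bspec, symmetric] that by simp
    also have "\<dots> = (\<Sum>e\<in>E. d e a * (\<Sum>e'\<in>E. d e' b * (\<Sum>e''\<in>E. d e'' c * f (e, e', e''))))"
      unfolding 1 unfolding 2 unfolding 3 ..
    finally show ?thesis by (simp add: sum_distrib_left mult_ac)
  qed
  have "ev f p =
      ev (\<lambda>(a, b, c). \<Sum>e\<in>E. \<Sum>e'\<in>E. \<Sum>e''\<in>E. f (e, e', e'') * (d e a * d e' b * d e'' c)) p"
    unfolding lin_ext_def by (rule sum.cong[OF refl]) (force simp: K_def intro!: f')
  also have "\<dots> = (\<Sum>e\<in>E. \<Sum>e'\<in>E. \<Sum>e''\<in>E.
      f (e, e', e'') * ev (\<lambda>(a, b, c). d e a * d e' b * d e'' c) p)"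
    by (simp add: case_prod_unfold ev_sum ev_mult_left)
  finally show ?thesis using 0 E by simp
qed

section \<open>Equality of tensors tested by functionals\<close>

lemma relators2_memI:
  "gen (a + a', b) - gen (a, b) - gen (a', b) \<in> relators2 scale"
  "gen (b, a + a') - gen (b, a) - gen (b, a') \<in> relators2 scale"
  "gen (c *s a, b) - fscale c (gen (a, b)) \<in> relators2 scale"
  "gen (a, c *s b) - fscale c (gen (a, b)) \<in> relators2 scale"
  unfolding relators2_def
  by ((rule UnI1 UnI2, (rule UN_I[OF UNIV_I])+, rule insertI1 insertI2[OF insertI1])[1])+

lemma relators3_memI:
  "gen (a + a', b, c) - gen (a, b, c) - gen (a', b, c) \<in> relators3 scale"
  "gen (b, a + a', c) - gen (b, a, c) - gen (b, a', c) \<in> relators3 scale"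
  "gen (b, c, a + a') - gen (b, c, a) - gen (b, c, a') \<in> relators3 scale"
  "gen (r *s a, b, c) - fscale r (gen (a, b, c)) \<in> relators3 scale"
  "gen (a, r *s b, c) - fscale r (gen (a, b, c)) \<in> relators3 scale"
  "gen (a, b, r *s c) - fscale r (gen (a, b, c)) \<in> relators3 scale"
  unfolding relators3_def
  by ((rule UnI1 UnI2, (rule UN_I[OF UNIV_I])+,
      rule insertI1 insertI2[OF insertI1] insertI2[OF insertI2[OF insertI1]])[1])+

text \<open>If p - q were outside the span of the relators, a separating functional, read on
  generators, would be a bilinear form, and \<open>bilin_ev_eq_0\<close> makes its value at p - q
  vanish.\<close>

lemma class2_eqI:
  assumes "\<And>\<alpha> \<beta>. \<lbrakk>\<alpha> \<in> dual scale; \<beta> \<in> dual scale\<rbrakk>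
    \<Longrightarrow> ev (\<lambda>(a, b). \<alpha> a * \<beta> b) p = ev (\<lambda>(a, b). \<alpha> a * \<beta> b) q"
  shows "class2 scale p = class2 scale q"
proof -
  interpret F: vector_space "fscale :: 'a \<Rightarrow> ('b \<times> 'b \<Rightarrow>\<^sub>0 'a) \<Rightarrow> _" by (rule vector_space_fscale)
  have "p - q \<in> F.span (relators2 scale)"
  proof (rule ccontr)
    assume "p - q \<notin> F.span (relators2 scale)"
    from F.exists_separating_functional[OF this] obtain \<phi>
      where \<phi>: "Vector_Spaces.linear fscale (*) \<phi>"
        and \<phi>0: "\<forall>r\<in>F.span (relators2 scale). \<phi> r = 0" and nz: "\<phi> (p - q) \<noteq> 0"
      by (elim exE conjE)
    have 0: "\<phi> r = 0" if "r \<in> relators2 scale" for r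
      using \<phi>0 F.span_base[OF that] by (rule bspec)
    note \<phi>' = \<phi>[folded module_hom_iff_linear]
    have add: "\<phi> (gen x) = \<phi> (gen y) + \<phi> (gen z)"
      if "gen x - gen y - gen z \<in> relators2 scale" for x y z
      using 0[OF that] by (simp add: module_hom.diff[OF \<phi>'] diff_eq_eq add.commute)
    have scl: "\<phi> (gen x) = c * \<phi> (gen y)" if "gen x - fscale c (gen y) \<in> relators2 scale" for x c y
      using 0[OF that] by (simp add: module_hom.diff[OF \<phi>'] module_hom.scale[OF \<phi>'])
    have "bilin (\<lambda>x. \<phi> (gen x))"
      unfolding bilin_def dual_iff
      by (intro conjI allI add scl relators2_memI)
    then have "ev (\<lambda>x. \<phi> (gen x)) (p - q) = 0"
      by (rule bilin_ev_eq_0) (simp add: assms ev_diff)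
    with nz show False by (simp flip: ev_linear_functional[OF \<phi>])
  qed
  then show ?thesis
    unfolding class2_def by (intro equiv_class_eq[OF equiv_quot_rel]) (simp add: quot_rel_def)
qed

lemma class3_eqI:
  assumes "\<And>\<alpha> \<beta> \<gamma>. \<lbrakk>\<alpha> \<in> dual scale; \<beta> \<in> dual scale; \<gamma> \<in> dual scale\<rbrakk>
    \<Longrightarrow> ev (\<lambda>(a, b, c). \<alpha> a * \<beta> b * \<gamma> c) p = ev (\<lambda>(a, b, c). \<alpha> a * \<beta> b * \<gamma> c) q"
  shows "class3 scale p = class3 scale q"
proof -
  interpret F: vector_space "fscale :: 'a \<Rightarrow> ('b \<times> 'b \<times> 'b \<Rightarrow>\<^sub>0 'a) \<Rightarrow> _"
    by (rule vector_space_fscale)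
  have "p - q \<in> F.span (relators3 scale)"
  proof (rule ccontr)
    assume "p - q \<notin> F.span (relators3 scale)"
    from F.exists_separating_functional[OF this] obtain \<phi>
      where \<phi>: "Vector_Spaces.linear fscale (*) \<phi>"
        and \<phi>0: "\<forall>r\<in>F.span (relators3 scale). \<phi> r = 0" and nz: "\<phi> (p - q) \<noteq> 0"
      by (elim exE conjE)
    have 0: "\<phi> r = 0" if "r \<in> relators3 scale" for r
      using \<phi>0 F.span_base[OF that] by (rule bspec)
    note \<phi>' = \<phi>[folded module_hom_iff_linear]
    have add: "\<phi> (gen x) = \<phi> (gen y) + \<phi> (gen z)"
      if "gen x - gen y - gen z \<in> relators3 scale" for x y z
      using 0[OF that] by (simp add: module_hom.diff[OF \<phi>'] diff_eq_eq add.commute)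
    have scl: "\<phi> (gen x) = c * \<phi> (gen y)" if "gen x - fscale c (gen y) \<in> relators3 scale" for x c y
      using 0[OF that] by (simp add: module_hom.diff[OF \<phi>'] module_hom.scale[OF \<phi>'])
    have "trilin (\<lambda>x. \<phi> (gen x))"
      unfolding trilin_def dual_iff
      by (intro conjI allI add scl relators3_memI)
    then have "ev (\<lambda>x. \<phi> (gen x)) (p - q) = 0"
      by (rule trilin_ev_eq_0) (simp add: assms ev_diff)
    with nz show False by (simp flip: ev_linear_functional[OF \<phi>])
  qed
  then show ?thesis
    unfolding class3_def by (intro equiv_class_eq[OF equiv_quot_rel]) (simp add: quot_rel_def)
qed

lemma pair2_class2:
  assumes "\<alpha> \<in> dual scale" "\<beta> \<in> dual scale"
  shows "pair2 \<alpha> \<beta> (class2 scale p) = ev (\<lambda>(a, b). \<alpha> a * \<beta> b) p"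
  unfolding pair2_def by (rule ev_class2[OF bilin_tensor[OF assms]])

lemma tensor2_class2: "T \<in> tensor2 scale \<Longrightarrow> T = class2 scale (rep T)"
  unfolding tensor2_def class2_def
  by (metis equiv_class_eq equiv_quot_rel quotientE rep_class)

lemma class2_in_tensor2: "class2 scale p \<in> tensor2 scale"
  by (auto simp: tensor2_def class2_def intro: quotientI)

lemma tensor2_eqI:
  assumes "T \<in> tensor2 scale" "T' \<in> tensor2 scale"
    and "\<And>\<alpha> \<beta>. \<lbrakk>\<alpha> \<in> dual scale; \<beta> \<in> dual scale\<rbrakk> \<Longrightarrow> pair2 \<alpha> \<beta> T = pair2 \<alpha> \<beta> T'"
  shows "T = T'"
  using class2_eqI[of "rep T" "rep T'"] assms tensor2_class2 by (metis pair2_def)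

section \<open>The weak-* topology\<close>

lemma topspace_weak_star [simp]: "topspace (weak_star scale) = dual scale"
  by (simp add: weak_star_def)

lemma openin_weak_star_agree:
  assumes "finite K"
  shows "openin (weak_star scale) {\<alpha> \<in> dual scale. \<forall>x\<in>K. \<alpha> x = \<alpha>\<^sub>0 x}"
proof -
  have *: "{\<alpha> \<in> dual scale. \<forall>x\<in>K. \<alpha> x = \<alpha>\<^sub>0 x} =
      (\<Pi>\<^sub>E x\<in>UNIV. if x \<in> K then {\<alpha>\<^sub>0 x} else UNIV) \<inter> dual scale"
    by (auto simp: PiE_iff extensional_def split: if_splits)
  have "finite {x. (if x \<in> K then {\<alpha>\<^sub>0 x} else UNIV) \<noteq> UNIV}"
    using assms by (rule rev_finite_subset) auto
  then show ?thesis
    unfolding weak_star_def openin_subtopology *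
    by (intro exI conjI refl) (auto simp: openin_PiE_gen)
qed

lemma openin_weak_starD:
  assumes "openin (weak_star scale) U" "\<alpha>\<^sub>0 \<in> U"
  obtains K where "finite K" "\<And>\<alpha>. \<lbrakk>\<alpha> \<in> dual scale; \<forall>x\<in>K. \<alpha> x = \<alpha>\<^sub>0 x\<rbrakk> \<Longrightarrow> \<alpha> \<in> U"
proof -
  obtain T where T: "openin (product_topology (\<lambda>_. discrete_topology UNIV) UNIV) T"
    and U: "U = T \<inter> dual scale"
    using assms(1) unfolding weak_star_def openin_subtopology by blast
  obtain W where W: "finite {x. W x \<noteq> UNIV}" "\<alpha>\<^sub>0 \<in> Pi\<^sub>E UNIV W" "Pi\<^sub>E UNIV W \<subseteq> T"
    using T assms(2) unfolding U openin_product_topology_alt by auto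
  \<comment> \<open>K consists of the coordinates that the basic open set given by W
    restricts.\<close>
  show thesis
  proof (rule that[OF W(1)])
    fix \<alpha> assume "\<alpha> \<in> dual scale" and eq: "\<forall>x\<in>{x. W x \<noteq> UNIV}. \<alpha> x = \<alpha>\<^sub>0 x"
    have "\<alpha> x \<in> W x" for x
      using eq W(2) by (cases "W x = UNIV") (auto simp: PiE_iff)
    then show "\<alpha> \<in> U" using W(3) \<open>\<alpha> \<in> dual scale\<close> by (auto simp: U PiE_iff)
  qed
qed

text \<open>A functional is determined by its values on the finite basis B, so a single functional
  is already a basic open set.\<close>

lemma weak_star_finite_dimensional:
  assumes "finite_dimensional_vector_space scale B"
  shows "weak_star scale = discrete_topology (dual scale)"
proof (rule sym, subst discrete_topology_unique, intro conjI ballI)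
  interpret F: finite_dimensional_vector_space scale B by fact
  fix \<alpha>\<^sub>0 assume \<alpha>\<^sub>0: "\<alpha>\<^sub>0 \<in> dual scale"
  interpret K: vector_space "(*) :: 'a \<Rightarrow> 'a \<Rightarrow> 'a" by (rule vector_space_mult)
  interpret P: vector_space_pair scale "(*) :: 'a \<Rightarrow> 'a \<Rightarrow> 'a" ..
  have "\<alpha> = \<alpha>\<^sub>0" if "\<alpha> \<in> dual scale" "\<forall>x\<in>B. \<alpha> x = \<alpha>\<^sub>0 x" for \<alpha>
    using that \<alpha>\<^sub>0 P.linear_eq_on[of \<alpha> \<alpha>\<^sub>0 _ B] F.span_Basis by (auto simp: dual_def)
  with \<alpha>\<^sub>0 have eq: "{\<alpha>\<^sub>0} = {\<alpha> \<in> dual scale. \<forall>x\<in>B. \<alpha> x = \<alpha>\<^sub>0 x}" by auto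
  show "openin (weak_star scale) {\<alpha>\<^sub>0}"
    unfolding eq by (rule openin_weak_star_agree[OF F.finite_Basis])
qed simp

text \<open>The value of the product at a involves \<alpha> and \<beta> only at the finitely many
  vectors in the representative of \<open>T a\<close>. It is therefore locally constant, hence
  continuous into the discrete field.\<close>

lemma continuous_map_weak_star_bilinearI:
  fixes m :: "('b \<Rightarrow> 'a) \<Rightarrow> ('b \<Rightarrow> 'a) \<Rightarrow> ('b \<Rightarrow> 'a)"
  assumes into: "\<And>\<alpha> \<beta>. \<lbrakk>\<alpha> \<in> dual scale; \<beta> \<in> dual scale\<rbrakk> \<Longrightarrow> m \<alpha> \<beta> \<in> dual scale"
    and m: "\<And>\<alpha> \<beta> a. \<lbrakk>\<alpha> \<in> dual scale; \<beta> \<in> dual scale\<rbrakk> \<Longrightarrow> m \<alpha> \<beta> a = pair2 \<alpha> \<beta> (T a)"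
  shows "continuous_map (prod_topology (weak_star scale) (weak_star scale)) (weak_star scale)
    (\<lambda>(\<alpha>, \<beta>). m \<alpha> \<beta>)"
proof -
  let ?X = "prod_topology (weak_star scale) (weak_star scale)"
  have "continuous_map ?X (discrete_topology UNIV) (\<lambda>(\<alpha>, \<beta>). m \<alpha> \<beta> a)" for a
    unfolding continuous_map_def
  proof (intro conjI allI impI)
    fix V assume "openin (discrete_topology (UNIV :: 'a set)) V"
    define K where "K = fst ` Poly_Mapping.keys (rep (T a)) \<union> snd ` Poly_Mapping.keys (rep (T a))"
    have K: "finite K" by (simp add: K_def)
    define N where "N \<alpha>\<^sub>0 = {\<alpha> \<in> dual scale. \<forall>x\<in>K. \<alpha> x = \<alpha>\<^sub>0 x}" for \<alpha>\<^sub>0 :: "'b \<Rightarrow> 'a"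
    have N: "openin (weak_star scale) (N \<alpha>\<^sub>0)" for \<alpha>\<^sub>0
      unfolding N_def by (rule openin_weak_star_agree[OF K])
    have eq: "m \<alpha> \<beta> a = m \<alpha>\<^sub>0 \<beta>\<^sub>0 a"
      if "\<alpha>\<^sub>0 \<in> dual scale" "\<beta>\<^sub>0 \<in> dual scale" "\<alpha> \<in> N \<alpha>\<^sub>0" "\<beta> \<in> N \<beta>\<^sub>0" for \<alpha> \<beta> \<alpha>\<^sub>0 \<beta>\<^sub>0
    proof -
      have "pair2 \<alpha> \<beta> (T a) = pair2 \<alpha>\<^sub>0 \<beta>\<^sub>0 (T a)"
        unfolding pair2_def lin_ext_def using that
        by (intro sum.cong[OF refl]) (force simp: K_def N_def)
      then show ?thesis using that m by (simp add: N_def)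
    qed
    show "openin ?X {x \<in> topspace ?X. (case x of (\<alpha>, \<beta>) \<Rightarrow> m \<alpha> \<beta> a) \<in> V}"
      unfolding openin_prod_topology_alt
    proof (intro allI impI)
      fix \<alpha>\<^sub>0 \<beta>\<^sub>0 assume *: "(\<alpha>\<^sub>0, \<beta>\<^sub>0) \<in> {x \<in> topspace ?X. (case x of (\<alpha>, \<beta>) \<Rightarrow> m \<alpha> \<beta> a) \<in> V}"
      then have 0: "\<alpha>\<^sub>0 \<in> dual scale" "\<beta>\<^sub>0 \<in> dual scale" "m \<alpha>\<^sub>0 \<beta>\<^sub>0 a \<in> V"
        by simp_all
      have "N \<alpha>\<^sub>0 \<times> N \<beta>\<^sub>0 \<subseteq> {x \<in> topspace ?X. (case x of (\<alpha>, \<beta>) \<Rightarrow> m \<alpha> \<beta> a) \<in> V}"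
      proof (rule subsetI, elim SigmaE)
        fix x \<alpha> \<beta> assume x: "\<alpha> \<in> N \<alpha>\<^sub>0" "\<beta> \<in> N \<beta>\<^sub>0" "x = (\<alpha>, \<beta>)"
        then have "m \<alpha> \<beta> a \<in> V" using eq[OF 0(1,2)] 0(3) by simp
        with x show "x \<in> {x \<in> topspace ?X. (case x of (\<alpha>, \<beta>) \<Rightarrow> m \<alpha> \<beta> a) \<in> V}"
          by (simp add: N_def)
      qed
      moreover have "\<alpha>\<^sub>0 \<in> N \<alpha>\<^sub>0" "\<beta>\<^sub>0 \<in> N \<beta>\<^sub>0" using 0 by (simp_all add: N_def)
      ultimately show "\<exists>U W. openin (weak_star scale) U \<and> openin (weak_star scale) W \<and> \<alpha>\<^sub>0 \<in> U \<and>
          \<beta>\<^sub>0 \<in> W \<and> U \<times> W \<subseteq> {x \<in> topspace ?X. (case x of (\<alpha>, \<beta>) \<Rightarrow> m \<alpha> \<beta> a) \<in> V}"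
        using N by blast
    qed
  qed simp
  then have "continuous_map ?X (product_topology (\<lambda>_. discrete_topology UNIV) UNIV) (\<lambda>(\<alpha>, \<beta>). m \<alpha> \<beta>)"
    by (simp add: continuous_map_componentwise_UNIV case_prod_unfold)
  moreover have "(\<lambda>(\<alpha>, \<beta>). m \<alpha> \<beta>) \<in> topspace ?X \<rightarrow> dual scale"
    using into by auto
  ultimately have "continuous_map ?X (subtopology (product_topology (\<lambda>_. discrete_topology UNIV) UNIV)
      (dual scale)) (\<lambda>(\<alpha>, \<beta>). m \<alpha> \<beta>)"
    by (rule continuous_map_into_subtopology)
  then show ?thesis by (simp only: weak_star_def)
qed

text \<open>Prescribing the value at a is an open condition on the product, so its preimage contains
  a box around the given pair. Each side of the box is controlled by finitely many values, and K is
  the union of the two finite sets.\<close>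

lemma weak_star_continuous_locally_constant:
  assumes cont: "continuous_map (prod_topology (weak_star scale) (weak_star scale)) (weak_star scale)
      (\<lambda>(\<alpha>, \<beta>). m \<alpha> \<beta>)"
    and "\<alpha>\<^sub>0 \<in> dual scale" "\<beta>\<^sub>0 \<in> dual scale"
  shows "\<exists>K. finite K \<and> (\<forall>\<alpha>\<in>dual scale. \<forall>\<beta>\<in>dual scale.
    (\<forall>x\<in>K. \<alpha> x = \<alpha>\<^sub>0 x) \<longrightarrow> (\<forall>x\<in>K. \<beta> x = \<beta>\<^sub>0 x) \<longrightarrow> m \<alpha> \<beta> a = m \<alpha>\<^sub>0 \<beta>\<^sub>0 a)"
proof -
  let ?X = "prod_topology (weak_star scale) (weak_star scale)"
  have m: "m \<alpha>\<^sub>0 \<beta>\<^sub>0 \<in> dual scale"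
    using continuous_map_image_subset_topspace[OF cont] assms(2,3) by force
  define N where "N = {\<alpha> \<in> dual scale. \<forall>x\<in>{a}. \<alpha> x = m \<alpha>\<^sub>0 \<beta>\<^sub>0 x}"
  have "openin ?X {x \<in> topspace ?X. (case x of (\<alpha>, \<beta>) \<Rightarrow> m \<alpha> \<beta>) \<in> N}"
    using cont openin_weak_star_agree[of "{a}"] unfolding continuous_map_def N_def by blast
  moreover have "(\<alpha>\<^sub>0, \<beta>\<^sub>0) \<in> {x \<in> topspace ?X. (case x of (\<alpha>, \<beta>) \<Rightarrow> m \<alpha> \<beta>) \<in> N}"
    using assms m by (simp add: N_def)
  ultimately obtain U W where U: "openin (weak_star scale) U" "\<alpha>\<^sub>0 \<in> U"
    and W: "openin (weak_star scale) W" "\<beta>\<^sub>0 \<in> W"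
    and UW: "U \<times> W \<subseteq> {x \<in> topspace ?X. (case x of (\<alpha>, \<beta>) \<Rightarrow> m \<alpha> \<beta>) \<in> N}"
    unfolding openin_prod_topology_alt by meson
  obtain K where K: "finite K" "\<And>\<alpha>. \<lbrakk>\<alpha> \<in> dual scale; \<forall>x\<in>K. \<alpha> x = \<alpha>\<^sub>0 x\<rbrakk> \<Longrightarrow> \<alpha> \<in> U"
    using openin_weak_starD[OF U] by metis
  obtain K' where K': "finite K'" "\<And>\<beta>. \<lbrakk>\<beta> \<in> dual scale; \<forall>x\<in>K'. \<beta> x = \<beta>\<^sub>0 x\<rbrakk> \<Longrightarrow> \<beta> \<in> W"
    using openin_weak_starD[OF W] by metis
  have "m \<alpha> \<beta> a = m \<alpha>\<^sub>0 \<beta>\<^sub>0 a" if "\<alpha> \<in> dual scale" "\<beta> \<in> dual scale"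
    "\<forall>x\<in>K \<union> K'. \<alpha> x = \<alpha>\<^sub>0 x" "\<forall>x\<in>K \<union> K'. \<beta> x = \<beta>\<^sub>0 x" for \<alpha> \<beta>
  proof -
    have "(\<alpha>, \<beta>) \<in> U \<times> W" using K K' that by blast
    then show ?thesis using UW by (auto simp: N_def)
  qed
  then show ?thesis using K(1) K'(1) by (intro exI[of _ "K \<union> K'"]) auto
qed

end

section \<open>Sweedler calculus\<close>

context hopf_algebra
begin

text \<open>The rules from here to \<open>ev_id_cop\<close> turn pairings with products, legs and
  coproducts into iterated sums over representatives. Multilinearity of f strips the outermost
  class; the representatives of the arguments are kept as they are.\<close>

lemma ev_mult2:
  assumes "bilin f"
  shows "ev f (rep (mult2 smul U V)) =
    ev (\<lambda>(a, b). ev (\<lambda>(a', b'). f (a * a', b * b')) (rep V)) (rep U)"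
  by (simp add: mult2_def ev_class2[OF assms] ev_lin_ext case_prod_unfold)

lemma ev_mult3:
  assumes "trilin f"
  shows "ev f (rep (mult3 smul U V)) =
    ev (\<lambda>(a, b, c). ev (\<lambda>(a', b', c'). f (a * a', b * b', c * c')) (rep V)) (rep U)"
  by (simp add: mult3_def ev_class3[OF assms] ev_lin_ext case_prod_unfold)

lemma ev_leg12: "trilin f \<Longrightarrow> ev f (rep (leg12 smul T)) = ev (\<lambda>(a, b). f (a, b, 1)) (rep T)"
  by (simp add: leg12_def ev_class3 ev_lin_ext case_prod_unfold)

lemma ev_leg23: "trilin f \<Longrightarrow> ev f (rep (leg23 smul T)) = ev (\<lambda>(a, b). f (1, a, b)) (rep T)"
  by (simp add: leg23_def ev_class3 ev_lin_ext case_prod_unfold)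

lemma ev_cop_id:
  "trilin f \<Longrightarrow> ev f (rep (cop_id smul \<Delta> T)) =
    ev (\<lambda>(a, b). ev (\<lambda>(u, v). f (u, v, b)) (rep (\<Delta> a))) (rep T)"
  by (simp add: cop_id_def ev_class3 ev_lin_ext case_prod_unfold)

lemma ev_id_cop:
  "trilin f \<Longrightarrow> ev f (rep (id_cop smul \<Delta> T)) =
    ev (\<lambda>(a, b). ev (\<lambda>(u, v). f (a, u, v)) (rep (\<Delta> b))) (rep T)"
  by (simp add: id_cop_def ev_class3 ev_lin_ext case_prod_unfold)

text \<open>On representatives the coproduct is linear only modulo the relators; a bilinear form
  does not see the difference.\<close>

lemma dual_ev_cop: "bilin f \<Longrightarrow> (\<lambda>a. ev f (rep (\<Delta> a))) \<in> dual smul"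
  by (simp add: dual_iff cop_add cop_scale ev_class2 ev_add ev_fscale)

lemma ev_cop_mult:
  assumes "bilin f"
  shows "ev f (rep (\<Delta> (a * b))) =
    ev (\<lambda>(x, y). ev (\<lambda>(x', y'). f (x * x', y * y')) (rep (\<Delta> b))) (rep (\<Delta> a))"
  using assms by (simp add: cop_mult ev_mult2)

lemma ev_cop_one: "bilin f \<Longrightarrow> ev f (rep (\<Delta> 1)) = f (1, 1)"
  by (simp add: cop_one ev_class2)

lemma ev_coassoc:
  assumes "trilin f"
  shows "ev (\<lambda>(x, y). ev (\<lambda>(u, v). f (u, v, y)) (rep (\<Delta> x))) (rep (\<Delta> a)) =
    ev (\<lambda>(x, y). ev (\<lambda>(u, v). f (x, u, v)) (rep (\<Delta> y))) (rep (\<Delta> a))"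
  using coassoc[of a] ev_cop_id[OF assms] ev_id_cop[OF assms] by metis

lemma counit_dual: "\<epsilon> \<in> dual smul"
  using counit_linear by (simp add: dual_def)

lemma ev_counit_left:
  assumes "\<alpha> \<in> dual smul"
  shows "ev (\<lambda>(x, y). \<epsilon> x * \<alpha> y) (rep (\<Delta> a)) = \<alpha> a"
proof -
  have "\<alpha> (lin_ext smul (\<lambda>(x, y). \<epsilon> x *s y) (rep (\<Delta> a))) =
      ev (\<lambda>z. \<alpha> ((\<lambda>(x, y). \<epsilon> x *s y) z)) (rep (\<Delta> a))"
    using assms by (intro linear_lin_ext_apply vector_space_axioms) (simp add: dual_def)
  then show ?thesis
    using assms counit_left[of a] by (simp add: dual_iff case_prod_unfold)
qed

lemma ev_counit_right:
  assumes "\<alpha> \<in> dual smul"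
  shows "ev (\<lambda>(x, y). \<epsilon> y * \<alpha> x) (rep (\<Delta> a)) = \<alpha> a"
proof -
  have "\<alpha> (lin_ext smul (\<lambda>(x, y). \<epsilon> y *s x) (rep (\<Delta> a))) =
      ev (\<lambda>z. \<alpha> ((\<lambda>(x, y). \<epsilon> y *s x) z)) (rep (\<Delta> a))"
    using assms by (intro linear_lin_ext_apply vector_space_axioms) (simp add: dual_def)
  then show ?thesis
    using assms counit_right[of a] by (simp add: dual_iff case_prod_unfold)
qed

lemma dual_mult_left: "\<alpha> \<in> dual smul \<Longrightarrow> (\<lambda>x. \<alpha> (b * x)) \<in> dual smul"
  and dual_mult_right: "\<alpha> \<in> dual smul \<Longrightarrow> (\<lambda>x. \<alpha> (x * b)) \<in> dual smul"
  by (simp_all add: dual_iff distrib_left distrib_right scale_mult_left scale_mult_right)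

lemma act_dual: "\<alpha> \<in> dual smul \<Longrightarrow> act \<alpha> b \<in> dual smul"
  by (simp add: act_def dual_mult_right)

lemma act_add: "\<alpha> \<in> dual smul \<Longrightarrow> act \<alpha> (x + y) = (\<lambda>z. act \<alpha> x z + act \<alpha> y z)"
  and act_scale: "\<alpha> \<in> dual smul \<Longrightarrow> act \<alpha> (c *s x) = (\<lambda>z. c * act \<alpha> x z)"
  by (simp_all add: act_def dual_iff distrib_left scale_mult_right)

lemma act_counit: "act \<epsilon> x = (\<lambda>z. \<epsilon> x * \<epsilon> z)"
  by (simp add: act_def counit_mult mult.commute)

section \<open>Equivariant bilinear multiplications\<close>

text \<open>This is \<open>module_algebra\<close> without associativity and without the behaviour
  outside the dual: the part that \<open>twist_mult F\<close> satisfies for every F, and the part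
  that determines a multiplication by its values at 1.\<close>

definition equivariant_mult :: "(('a \<Rightarrow> 'k) \<Rightarrow> ('a \<Rightarrow> 'k) \<Rightarrow> ('a \<Rightarrow> 'k)) \<Rightarrow> bool" where
  "equivariant_mult m \<longleftrightarrow>
     (\<forall>\<alpha>\<in>dual smul. \<forall>\<beta>\<in>dual smul. m \<alpha> \<beta> \<in> dual smul) \<and>
     (\<forall>\<alpha>\<in>dual smul. \<forall>\<beta>\<in>dual smul. \<forall>\<gamma>\<in>dual smul. \<forall>c a.
        m (\<lambda>x. \<alpha> x + \<beta> x) \<gamma> a = m \<alpha> \<gamma> a + m \<beta> \<gamma> a \<and>
        m \<gamma> (\<lambda>x. \<alpha> x + \<beta> x) a = m \<gamma> \<alpha> a + m \<gamma> \<beta> a \<and>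
        m (\<lambda>x. c * \<alpha> x) \<gamma> a = c * m \<alpha> \<gamma> a \<and>
        m \<gamma> (\<lambda>x. c * \<alpha> x) a = c * m \<gamma> \<alpha> a) \<and>
     (\<forall>\<alpha>\<in>dual smul. \<forall>\<beta>\<in>dual smul. \<forall>b a.
        act (m \<alpha> \<beta>) b a =
          ev (\<lambda>(b\<^sub>1, b\<^sub>2). m (act \<alpha> b\<^sub>1) (act \<beta> b\<^sub>2) a) (rep (\<Delta> b)))"

context
  fixes m assumes m: "equivariant_mult m"
begin

lemma mult_dual: "\<lbrakk>\<alpha> \<in> dual smul; \<beta> \<in> dual smul\<rbrakk> \<Longrightarrow> m \<alpha> \<beta> \<in> dual smul"
  using m unfolding equivariant_mult_def by blast

lemma mult_bilinear:
  assumes "\<alpha> \<in> dual smul" "\<beta> \<in> dual smul" "\<gamma> \<in> dual smul"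
  shows "m (\<lambda>x. \<alpha> x + \<beta> x) \<gamma> = (\<lambda>a. m \<alpha> \<gamma> a + m \<beta> \<gamma> a)"
    "m \<gamma> (\<lambda>x. \<alpha> x + \<beta> x) = (\<lambda>a. m \<gamma> \<alpha> a + m \<gamma> \<beta> a)"
    "m (\<lambda>x. c * \<alpha> x) \<gamma> = (\<lambda>a. c * m \<alpha> \<gamma> a)"
    "m \<gamma> (\<lambda>x. c * \<alpha> x) = (\<lambda>a. c * m \<gamma> \<alpha> a)"
  using m assms unfolding equivariant_mult_def by (auto intro!: ext)

lemma act_mult:
  "\<lbrakk>\<alpha> \<in> dual smul; \<beta> \<in> dual smul\<rbrakk> \<Longrightarrow>
    act (m \<alpha> \<beta>) b = (\<lambda>a. ev (\<lambda>(x, y). m (act \<alpha> x) (act \<beta> y) a) (rep (\<Delta> b)))"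
  using m unfolding equivariant_mult_def by (auto intro!: ext)

lemma mult_zero:
  assumes "\<gamma> \<in> dual smul"
  shows "m (\<lambda>x. 0) \<gamma> = (\<lambda>x. 0)" "m \<gamma> (\<lambda>x. 0) = (\<lambda>x. 0)"
  using mult_bilinear(3)[OF dual_zero dual_zero assms, of 0]
    mult_bilinear(4)[OF dual_zero dual_zero assms, of 0] by simp_all

lemma mult_lincomb_left:
  assumes "\<gamma> \<in> dual smul" "\<And>i. i \<in> I \<Longrightarrow> d i \<in> dual smul"
  shows "m (\<lambda>x. \<Sum>i\<in>I. c i * d i x) \<gamma> a = (\<Sum>i\<in>I. c i * m (d i) \<gamma> a)"
  using assms(2)
proof (induction I rule: infinite_finite_induct)
  case (insert i I)
  have "(\<lambda>x. c i * d i x) \<in> dual smul" "(\<lambda>x. \<Sum>i\<in>I. c i * d i x) \<in> dual smul"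
    using insert.prems dual_lincomb[of "{i}" d c] dual_lincomb[of I d c] by simp_all
  with insert assms(1) show ?case
    by (simp add: mult_bilinear(1) mult_bilinear(3)[OF _ dual_zero])
qed (simp_all add: mult_zero assms(1))

lemma mult_lincomb_right:
  assumes "\<gamma> \<in> dual smul" "\<And>i. i \<in> I \<Longrightarrow> d i \<in> dual smul"
  shows "m \<gamma> (\<lambda>x. \<Sum>i\<in>I. c i * d i x) a = (\<Sum>i\<in>I. c i * m \<gamma> (d i) a)"
  using assms(2)
proof (induction I rule: infinite_finite_induct)
  case (insert i I)
  have "(\<lambda>x. c i * d i x) \<in> dual smul" "(\<lambda>x. \<Sum>i\<in>I. c i * d i x) \<in> dual smul"
    using insert.prems dual_lincomb[of "{i}" d c] dual_lincomb[of I d c] by simp_all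
  with insert assms(1) show ?case
    by (simp add: mult_bilinear(2) mult_bilinear(4)[OF _ dual_zero])
qed (simp_all add: mult_zero assms(1))

lemma mult_ev_left:
  assumes "\<gamma> \<in> dual smul" "\<And>z. f z \<in> dual smul"
  shows "m (\<lambda>x. ev (\<lambda>z. f z x) p) \<gamma> a = ev (\<lambda>z. m (f z) \<gamma> a) p"
  unfolding lin_ext_def by (rule mult_lincomb_left[OF assms])

lemma mult_ev_right:
  assumes "\<gamma> \<in> dual smul" "\<And>z. f z \<in> dual smul"
  shows "m \<gamma> (\<lambda>x. ev (\<lambda>z. f z x) p) a = ev (\<lambda>z. m \<gamma> (f z) a) p"
  unfolding lin_ext_def by (rule mult_lincomb_right[OF assms])

text \<open>Equivariance for b = a, read at the argument 1: acting by a and then evaluating at 1 is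
  evaluating at a.\<close>

lemma mult_eq_at_one:
  assumes "\<alpha> \<in> dual smul" "\<beta> \<in> dual smul"
  shows "m \<alpha> \<beta> a = ev (\<lambda>(x, y). m (act \<alpha> x) (act \<beta> y) 1) (rep (\<Delta> a))"
  using fun_cong[OF act_mult[OF assms], of a 1] by (simp add: act_def)

text \<open>Equivariance turns the two bracketings at a into sums over the two iterated coproducts
  of a, with one and the same trilinear form f of translated functionals at 1; coassociativity
  identifies the sums.\<close>

lemma mult_assocI:
  assumes 1: "\<And>\<alpha> \<beta> \<gamma>. \<lbrakk>\<alpha> \<in> dual smul; \<beta> \<in> dual smul; \<gamma> \<in> dual smul\<rbrakk>
      \<Longrightarrow> m (m \<alpha> \<beta>) \<gamma> 1 = m \<alpha> (m \<beta> \<gamma>) 1"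
    and d: "\<alpha> \<in> dual smul" "\<beta> \<in> dual smul" "\<gamma> \<in> dual smul"
  shows "m (m \<alpha> \<beta>) \<gamma> = m \<alpha> (m \<beta> \<gamma>)"
proof
  fix a
  define f where "f = (\<lambda>(x, y, z). m (m (act \<alpha> x) (act \<beta> y)) (act \<gamma> z) 1)"
  \<comment> \<open>The hypothesis at 1, applied to translated functionals, gives f a second shape
    with the other bracketing.\<close>
  have f': "f = (\<lambda>(x, y, z). m (act \<alpha> x) (m (act \<beta> y) (act \<gamma> z)) 1)"
    unfolding f_def using d 1 by (simp add: act_dual)
  note [simp] = act_dual mult_dual
  have f: "trilin f"
    unfolding trilin_def dual_iff f_def using d
    by (simp add: act_add act_scale mult_bilinear mult_bilinear(3,4)[OF _ dual_zero])
  have "m (m \<alpha> \<beta>) \<gamma> a = ev (\<lambda>(x, y). m (act (m \<alpha> \<beta>) x) (act \<gamma> y) 1) (rep (\<Delta> a))"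
    using d by (intro mult_eq_at_one) simp_all
  also have "\<dots> = ev (\<lambda>(x, y). ev (\<lambda>(u, v). f (u, v, y)) (rep (\<Delta> x))) (rep (\<Delta> a))"
    using d by (simp add: act_mult f_def case_prod_unfold mult_ev_left)
  also have "\<dots> = ev (\<lambda>(x, y). ev (\<lambda>(u, v). f (x, u, v)) (rep (\<Delta> y))) (rep (\<Delta> a))"
    by (rule ev_coassoc[OF f])
  also have "\<dots> = ev (\<lambda>(x, y). m (act \<alpha> x) (act (m \<beta> \<gamma>) y) 1) (rep (\<Delta> a))"
    using d by (simp add: act_mult f' case_prod_unfold mult_ev_right)
  also have "\<dots> = m \<alpha> (m \<beta> \<gamma>) a"
    using d by (intro mult_eq_at_one[symmetric]) simp_all
  finally show "m (m \<alpha> \<beta>) \<gamma> a = m \<alpha> (m \<beta> \<gamma>) a" .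
qed

text \<open>Translating \<epsilon> by x multiplies it by \<open>\<epsilon> x\<close>, so the law at
  1 leaves the sum of \<open>\<epsilon> x * f y\<close> over the coproduct, which the counit axiom
  evaluates.\<close>

lemma mult_unit_leftI:
  assumes 1: "\<And>f. f \<in> dual smul \<Longrightarrow> m \<epsilon> f 1 = f 1" and f: "f \<in> dual smul"
  shows "m \<epsilon> f = f"
proof
  fix a
  have "m \<epsilon> f a = ev (\<lambda>(x, y). m (act \<epsilon> x) (act f y) 1) (rep (\<Delta> a))"
    by (rule mult_eq_at_one[OF counit_dual f])
  also have "\<dots> = ev (\<lambda>(x, y). \<epsilon> x * f y) (rep (\<Delta> a))"
    using 1[OF act_dual[OF f]]
    by (simp add: act_counit mult_bilinear(3)[OF counit_dual dual_zero act_dual[OF f]])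
      (simp add: act_def)
  finally show "m \<epsilon> f a = f a" by (simp add: ev_counit_left[OF f])
qed

lemma mult_unit_rightI:
  assumes 1: "\<And>f. f \<in> dual smul \<Longrightarrow> m f \<epsilon> 1 = f 1" and f: "f \<in> dual smul"
  shows "m f \<epsilon> = f"
proof
  fix a
  have "m f \<epsilon> a = ev (\<lambda>(x, y). m (act f x) (act \<epsilon> y) 1) (rep (\<Delta> a))"
    by (rule mult_eq_at_one[OF f counit_dual])
  also have "\<dots> = ev (\<lambda>(x, y). \<epsilon> y * f x) (rep (\<Delta> a))"
    using 1[OF act_dual[OF f]]
    by (simp add: act_counit mult_bilinear(4)[OF counit_dual dual_zero act_dual[OF f]])
      (simp add: act_def)
  finally show "m f \<epsilon> a = f a" by (simp add: ev_counit_right[OF f])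
qed

section \<open>Representing a continuous multiplication by a tensor\<close>

text \<open>When d is a dual basis for a finite set, the argument of the first term vanishes on that
  set and is accessible to continuity, while the sum uses only the values of \<alpha> on E.\<close>

lemma mult_split_left:
  assumes "\<alpha> \<in> dual smul" "\<beta> \<in> dual smul" "\<forall>e\<in>E. d e \<in> dual smul"
  shows "m \<alpha> \<beta> a =
    m (\<lambda>x. \<alpha> x - (\<Sum>e\<in>E. \<alpha> e * d e x)) \<beta> a + (\<Sum>e\<in>E. \<alpha> e * m (d e) \<beta> a)"
proof -
  have "m (\<lambda>x. (\<alpha> x - (\<Sum>e\<in>E. \<alpha> e * d e x)) + (\<Sum>e\<in>E. \<alpha> e * d e x)) \<beta> =
    (\<lambda>a. m (\<lambda>x. \<alpha> x - (\<Sum>e\<in>E. \<alpha> e * d e x)) \<beta> a + m (\<lambda>x. \<Sum>e\<in>E. \<alpha> e * d e x) \<beta> a)"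
    using assms by (intro mult_bilinear(1) dual_remainder dual_lincomb) auto
  moreover have "m (\<lambda>x. \<Sum>e\<in>E. \<alpha> e * d e x) \<beta> a = (\<Sum>e\<in>E. \<alpha> e * m (d e) \<beta> a)"
    using assms by (intro mult_lincomb_left) auto
  ultimately show ?thesis by simp
qed

lemma mult_split_right:
  assumes "\<alpha> \<in> dual smul" "\<beta> \<in> dual smul" "\<forall>e\<in>E. d e \<in> dual smul"
  shows "m \<alpha> \<beta> a =
    m \<alpha> (\<lambda>x. \<beta> x - (\<Sum>e\<in>E. \<beta> e * d e x)) a + (\<Sum>e\<in>E. \<beta> e * m \<alpha> (d e) a)"
proof -
  have "m \<alpha> (\<lambda>x. (\<beta> x - (\<Sum>e\<in>E. \<beta> e * d e x)) + (\<Sum>e\<in>E. \<beta> e * d e x)) =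
    (\<lambda>a. m \<alpha> (\<lambda>x. \<beta> x - (\<Sum>e\<in>E. \<beta> e * d e x)) a + m \<alpha> (\<lambda>x. \<Sum>e\<in>E. \<beta> e * d e x) a)"
    using assms by (intro mult_bilinear(2) dual_remainder dual_lincomb) auto
  moreover have "m \<alpha> (\<lambda>x. \<Sum>e\<in>E. \<beta> e * d e x) a = (\<Sum>e\<in>E. \<beta> e * m \<alpha> (d e) a)"
    using assms by (intro mult_lincomb_right) auto
  ultimately show ?thesis by simp
qed

text \<open>The aim is a finite set M such that the form vanishes as soon as one argument alone
  vanishes on M. Then both arguments may be replaced by their interpolants on M, and the form
  becomes a finite double sum.\<close>

lemma exists_tensor_of_continuous:
  assumes cont: "continuous_map (prod_topology (weak_star smul) (weak_star smul)) (weak_star smul)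
      (\<lambda>(\<alpha>, \<beta>). m \<alpha> \<beta>)"
  shows "\<exists>F\<in>tensor2 smul. \<forall>\<alpha>\<in>dual smul. \<forall>\<beta>\<in>dual smul. m \<alpha> \<beta> 1 = pair2 \<alpha> \<beta> F"
proof -
  note const = weak_star_continuous_locally_constant[OF cont, where a = 1]
  obtain K where K: "finite K" "\<forall>\<alpha>\<in>dual smul. \<forall>\<beta>\<in>dual smul.
      (\<forall>x\<in>K. \<alpha> x = 0) \<longrightarrow> (\<forall>x\<in>K. \<beta> x = 0) \<longrightarrow> m \<alpha> \<beta> 1 = 0"
    using const[OF dual_zero dual_zero] unfolding mult_zero(1)[OF dual_zero] by (elim exE conjE)
  obtain E d where E: "finite E" "\<forall>e\<in>E. d e \<in> dual smul" "\<forall>x\<in>K. x = (\<Sum>e\<in>E. d e x *s e)"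
    using finite_dual_basis[OF K(1)] by (elim exE conjE)
  \<comment> \<open>Continuity at (0, d e): with \<open>d e\<close> held fixed in the second slot,
    vanishing of the first argument on a finite set suffices. There are only finitely many e to
    treat.\<close>
  have "\<exists>L. finite L \<and> (\<forall>\<alpha>\<in>dual smul. (\<forall>x\<in>L. \<alpha> x = 0) \<longrightarrow> m \<alpha> (d e) 1 = 0)" if "e \<in> E" for e
  proof -
    have de: "d e \<in> dual smul" using E(2) that by blast
    show ?thesis
      using const[OF dual_zero de] de unfolding mult_zero(1)[OF de] by (elim ex_forward) simp
  qed
  then have "\<forall>e\<in>E. \<exists>L. finite L \<and> (\<forall>\<alpha>\<in>dual smul. (\<forall>x\<in>L. \<alpha> x = 0) \<longrightarrow> m \<alpha> (d e) 1 = 0)"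
    by (rule ballI)
  from bchoice[OF this] obtain L where L: "\<forall>e\<in>E. finite (L e) \<and>
      (\<forall>\<alpha>\<in>dual smul. (\<forall>x\<in>L e. \<alpha> x = 0) \<longrightarrow> m \<alpha> (d e) 1 = 0)"
    by (elim exE)
  have "\<exists>R. finite R \<and> (\<forall>\<beta>\<in>dual smul. (\<forall>x\<in>R. \<beta> x = 0) \<longrightarrow> m (d e) \<beta> 1 = 0)" if "e \<in> E" for e
  proof -
    have de: "d e \<in> dual smul" using E(2) that by blast
    show ?thesis
      using const[OF de dual_zero] de unfolding mult_zero(2)[OF de] by (elim ex_forward) simp
  qed
  then have "\<forall>e\<in>E. \<exists>R. finite R \<and> (\<forall>\<beta>\<in>dual smul. (\<forall>x\<in>R. \<beta> x = 0) \<longrightarrow> m (d e) \<beta> 1 = 0)"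
    by (rule ballI)
  from bchoice[OF this] obtain R where R: "\<forall>e\<in>E. finite (R e) \<and>
      (\<forall>\<beta>\<in>dual smul. (\<forall>x\<in>R e. \<beta> x = 0) \<longrightarrow> m (d e) \<beta> 1 = 0)"
    by (elim exE)
  define M where "M = K \<union> (\<Union>e\<in>E. L e) \<union> (\<Union>e\<in>E. R e)"
  \<comment> \<open>Both \<alpha> and the remainder of \<beta> vanish on K, which disposes of the
    remainder term; each correction term contains \<open>m \<alpha> (d e) 1\<close> and is killed
    because \<alpha> vanishes on \<open>L e\<close>.\<close>
  have left: "m \<alpha> \<beta> 1 = 0" if "\<alpha> \<in> dual smul" "\<beta> \<in> dual smul" "\<forall>x\<in>M. \<alpha> x = 0" for \<alpha> \<beta>
  proof -
    let ?\<beta>' = "\<lambda>x. \<beta> x - (\<Sum>e\<in>E. \<beta> e * d e x)"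
    have "m \<alpha> ?\<beta>' 1 = 0"
      using K(2) that dual_remainder[OF that(2) E(2)] remainder_eq_0[OF that(2) E(3)]
      by (simp add: M_def)
    moreover have "(\<Sum>e\<in>E. \<beta> e * m \<alpha> (d e) 1) = 0"
    proof (intro sum.neutral ballI)
      fix e assume e: "e \<in> E"
      then have "\<forall>x\<in>L e. \<alpha> x = 0" using that(3) by (auto simp: M_def)
      then have "m \<alpha> (d e) 1 = 0" using bspec[OF L e] that(1,2) by blast
      then show "\<beta> e * m \<alpha> (d e) 1 = 0" by simp
    qed
    ultimately show ?thesis
      unfolding mult_split_right[OF that(1,2) E(2)] by simp
  qed
  have right: "m \<alpha> \<beta> 1 = 0" if "\<alpha> \<in> dual smul" "\<beta> \<in> dual smul" "\<forall>x\<in>M. \<beta> x = 0" for \<alpha> \<beta>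
  proof -
    let ?\<alpha>' = "\<lambda>x. \<alpha> x - (\<Sum>e\<in>E. \<alpha> e * d e x)"
    have "m ?\<alpha>' \<beta> 1 = 0"
      using K(2) that dual_remainder[OF that(1) E(2)] remainder_eq_0[OF that(1) E(3)]
      by (simp add: M_def)
    moreover have "(\<Sum>e\<in>E. \<alpha> e * m (d e) \<beta> 1) = 0"
    proof (intro sum.neutral ballI)
      fix e assume e: "e \<in> E"
      then have "\<forall>x\<in>R e. \<beta> x = 0" using that(3) by (auto simp: M_def)
      then have "m (d e) \<beta> 1 = 0" using bspec[OF R e] that(1,2) by blast
      then show "\<alpha> e * m (d e) \<beta> 1 = 0" by simp
    qed
    ultimately show ?thesis
      unfolding mult_split_left[OF that(1,2) E(2)] by simp
  qed
  have "finite M" using K(1) E(1) L R by (simp add: M_def)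
  obtain E' d' where E': "finite E'" "\<forall>e\<in>E'. d' e \<in> dual smul"
      "\<forall>x\<in>M. x = (\<Sum>e\<in>E'. d' e x *s e)"
    using finite_dual_basis[OF \<open>finite M\<close>] by (elim exE conjE)
  \<comment> \<open>The coefficients are the values of the form at pairs of coordinate functionals
    for M: inserting the two interpolants into the form gives exactly the pairing with p.\<close>
  define p where "p = (\<Sum>e\<in>E'. \<Sum>e'\<in>E'. Poly_Mapping.single (e, e') (m (d' e) (d' e') 1))"
  have "m \<alpha> \<beta> 1 = pair2 \<alpha> \<beta> (class2 smul p)" if \<alpha>\<beta>: "\<alpha> \<in> dual smul" "\<beta> \<in> dual smul" for \<alpha> \<beta>
  proof -
    have *: "m (d' e) \<beta> 1 = (\<Sum>e'\<in>E'. \<beta> e' * m (d' e) (d' e') 1)" if "e \<in> E'" for e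
    proof -
      have de: "d' e \<in> dual smul" using E'(2) that by blast
      have "m (d' e) (\<lambda>x. \<beta> x - (\<Sum>e\<in>E'. \<beta> e * d' e x)) 1 = 0"
        by (intro right de dual_remainder[OF \<alpha>\<beta>(2) E'(2)] remainder_eq_0[OF \<alpha>\<beta>(2) E'(3)] ballI)
      then show ?thesis
        unfolding mult_split_right[OF de \<alpha>\<beta>(2) E'(2)] by simp
    qed
    have "m (\<lambda>x. \<alpha> x - (\<Sum>e\<in>E'. \<alpha> e * d' e x)) \<beta> 1 = 0"
      by (intro left \<alpha>\<beta>(2) dual_remainder[OF \<alpha>\<beta>(1) E'(2)] remainder_eq_0[OF \<alpha>\<beta>(1) E'(3)] ballI)
    then have "m \<alpha> \<beta> 1 = (\<Sum>e\<in>E'. \<alpha> e * m (d' e) \<beta> 1)"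
      unfolding mult_split_left[OF \<alpha>\<beta> E'(2)] by simp
    also have "\<dots> = (\<Sum>e\<in>E'. \<alpha> e * (\<Sum>e'\<in>E'. \<beta> e' * m (d' e) (d' e') 1))"
      by (simp add: *)
    also have "\<dots> = ev (\<lambda>(a, b). \<alpha> a * \<beta> b) p"
      by (simp add: p_def ev_sum_arg ev_single sum_distrib_left mult_ac)
    finally show ?thesis by (simp add: pair2_class2[OF \<alpha>\<beta>])
  qed
  then show ?thesis by (intro bexI[of _ "class2 smul p"] class2_in_tensor2) auto
qed

end

end

section \<open>The multiplication defined by a tensor\<close>

context hopf_algebra
begin

definition twist_mult ::
    "('a \<times> 'a \<Rightarrow>\<^sub>0 'k) set \<Rightarrow> ('a \<Rightarrow> 'k) \<Rightarrow> ('a \<Rightarrow> 'k) \<Rightarrow> ('a \<Rightarrow> 'k)" where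
  "twist_mult F = (\<lambda>\<alpha>\<in>dual smul. \<lambda>\<beta>\<in>dual smul. \<lambda>a. pair2 \<alpha> \<beta> (mult2 smul F (\<Delta> a)))"

lemma bilin_shift:
  assumes "\<alpha> \<in> dual smul" "\<beta> \<in> dual smul"
  shows "bilin (\<lambda>(x, y). \<alpha> (u * x) * \<beta> (v * y))"
  by (rule bilin_tensor[OF dual_mult_left[OF assms(1)] dual_mult_left[OF assms(2)]])

lemma twist_mult_eq:
  assumes "\<alpha> \<in> dual smul" "\<beta> \<in> dual smul"
  shows "twist_mult F \<alpha> \<beta> a =
    ev (\<lambda>(u, v). ev (\<lambda>(x, y). \<alpha> (u * x) * \<beta> (v * y)) (rep (\<Delta> a))) (rep F)"
  using assms by (simp add: twist_mult_def pair2_def ev_mult2 bilin_tensor)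

text \<open>Since \<Delta>(1) = 1 (x) 1, reading products at 1 recovers every pairing with F.
  Injectivity of the correspondence rests on this.\<close>

lemma twist_mult_one:
  assumes "\<alpha> \<in> dual smul" "\<beta> \<in> dual smul"
  shows "twist_mult F \<alpha> \<beta> 1 = pair2 \<alpha> \<beta> F"
  by (simp add: twist_mult_eq[OF assms] ev_cop_one bilin_shift[OF assms] pair2_def)

lemma twist_mult_dual:
  assumes "\<alpha> \<in> dual smul" "\<beta> \<in> dual smul"
  shows "twist_mult F \<alpha> \<beta> \<in> dual smul"
proof -
  have "(\<lambda>a. ev (\<lambda>(u, v). ev (\<lambda>(x, y). \<alpha> (u * x) * \<beta> (v * y)) (rep (\<Delta> a))) (rep F)) \<in> dual smul"
    unfolding case_prod_unfold
    by (intro dual_ev dual_ev_cop bilin_shift[OF assms, unfolded case_prod_unfold])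
  then show ?thesis by (simp add: twist_mult_eq[OF assms, abs_def])
qed

text \<open>Multiplicativity of the coproduct puts \<Delta>(b) on the far right of F \<Delta>(a),
  where it acts on \<alpha> and \<beta> by translation.\<close>

lemma twist_mult_act:
  assumes "\<alpha> \<in> dual smul" "\<beta> \<in> dual smul"
  shows "act (twist_mult F \<alpha> \<beta>) b a =
    ev (\<lambda>(x, y). twist_mult F (act \<alpha> x) (act \<beta> y) a) (rep (\<Delta> b))"
proof -
  let ?D = "rep (\<Delta> b)"
  have "act (twist_mult F \<alpha> \<beta>) b a = ev (\<lambda>(u, v). ev (\<lambda>(x, y). ev (\<lambda>(x', y').
      \<alpha> (u * x * x') * \<beta> (v * y * y')) ?D) (rep (\<Delta> a))) (rep F)"
    by (simp add: act_def twist_mult_eq[OF assms] ev_cop_mult[OF bilin_shift[OF assms]] mult.assoc)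
  \<comment> \<open>Two interchanges move the sum over the coproduct of b outside the sums over the
    coproduct of a and over F.\<close>
  also have "\<dots> = ev (\<lambda>q. ev (\<lambda>w. ev (\<lambda>z.
      \<alpha> (fst w * fst z * fst q) * \<beta> (snd w * snd z * snd q)) (rep (\<Delta> a))) (rep F)) ?D"
    unfolding case_prod_unfold by (subst ev_swap[of _ ?D]) (subst ev_swap[of _ ?D], rule refl)
  also have "\<dots> = ev (\<lambda>(x, y). twist_mult F (act \<alpha> x) (act \<beta> y) a) ?D"
    by (simp add: case_prod_unfold twist_mult_eq[OF act_dual[OF assms(1)] act_dual[OF assms(2)]])
      (simp add: act_def)
  finally show ?thesis .
qed

lemma equivariant_twist_mult: "equivariant_mult (twist_mult F)"
proof -
  have "twist_mult F (\<lambda>x. \<alpha> x + \<beta> x) \<gamma> a = twist_mult F \<alpha> \<gamma> a + twist_mult F \<beta> \<gamma> a"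
    "twist_mult F \<gamma> (\<lambda>x. \<alpha> x + \<beta> x) a = twist_mult F \<gamma> \<alpha> a + twist_mult F \<gamma> \<beta> a"
    "twist_mult F (\<lambda>x. c * \<alpha> x) \<gamma> a = c * twist_mult F \<alpha> \<gamma> a"
    "twist_mult F \<gamma> (\<lambda>x. c * \<alpha> x) a = c * twist_mult F \<gamma> \<alpha> a"
    if d: "\<alpha> \<in> dual smul" "\<beta> \<in> dual smul" "\<gamma> \<in> dual smul" for \<alpha> \<beta> \<gamma> c a
  proof -
    have "(\<lambda>x. \<alpha> x + \<beta> x) \<in> dual smul" "(\<lambda>x. c * \<alpha> x) \<in> dual smul"
      using d by (auto simp: dual_iff algebra_simps)
    with d show "twist_mult F (\<lambda>x. \<alpha> x + \<beta> x) \<gamma> a = twist_mult F \<alpha> \<gamma> a + twist_mult F \<beta> \<gamma> a"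
      "twist_mult F \<gamma> (\<lambda>x. \<alpha> x + \<beta> x) a = twist_mult F \<gamma> \<alpha> a + twist_mult F \<gamma> \<beta> a"
      "twist_mult F (\<lambda>x. c * \<alpha> x) \<gamma> a = c * twist_mult F \<alpha> \<gamma> a"
      "twist_mult F \<gamma> (\<lambda>x. c * \<alpha> x) a = c * twist_mult F \<gamma> \<alpha> a"
      by (simp_all add: twist_mult_eq case_prod_unfold distrib_left distrib_right ev_plus_fun
          ev_mult_left mult.assoc mult.left_commute)
  qed
  then show ?thesis
    by (simp add: equivariant_mult_def twist_mult_dual twist_mult_act)
qed

text \<open>Both sides are recovered from their values at 1 by the same formula. The case
  distinctions settle arguments outside the dual, where both are \<open>undefined\<close>.\<close>

lemma equivariant_eq_twist_mult:
  assumes m: "equivariant_mult m" and PiE: "m \<in> dual smul \<rightarrow>\<^sub>E (dual smul \<rightarrow>\<^sub>E dual smul)"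
    and 1: "\<And>\<alpha> \<beta>. \<lbrakk>\<alpha> \<in> dual smul; \<beta> \<in> dual smul\<rbrakk> \<Longrightarrow> m \<alpha> \<beta> 1 = pair2 \<alpha> \<beta> F"
  shows "m = twist_mult F"
proof (rule ext)
  fix \<alpha>
  show "m \<alpha> = twist_mult F \<alpha>"
  proof (cases "\<alpha> \<in> dual smul")
    case \<alpha>: True
    show ?thesis
    proof (rule ext)
      fix \<beta>
      show "m \<alpha> \<beta> = twist_mult F \<alpha> \<beta>"
      proof (cases "\<beta> \<in> dual smul")
        case \<beta>: True
        show ?thesis
        proof (rule ext)
          fix a
          show "m \<alpha> \<beta> a = twist_mult F \<alpha> \<beta> a"
            unfolding mult_eq_at_one[OF m \<alpha> \<beta>] mult_eq_at_one[OF equivariant_twist_mult \<alpha> \<beta>]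
            by (simp add: 1 twist_mult_one act_dual \<alpha> \<beta>)
        qed
      next
        case False
        then show ?thesis using \<alpha> PiE_arb[OF PiE_mem[OF PiE \<alpha>]] by (simp add: twist_mult_def)
      qed
    qed
  next
    case False
    then show ?thesis using PiE_arb[OF PiE] by (simp add: twist_mult_def)
  qed
qed

lemma twist_mult_PiE: "twist_mult F \<in> dual smul \<rightarrow>\<^sub>E (dual smul \<rightarrow>\<^sub>E dual smul)"
  using twist_mult_dual unfolding twist_mult_def by (auto simp: PiE_iff)

section \<open>Twist conditions as laws of the multiplication at 1\<close>

text \<open>At 1 the outer product pairs \<open>twist_mult F \<alpha> \<beta>\<close> and \<gamma>
  with F. Expanding the inner product comultiplies the first leg and multiplies it from the left by
  a second copy of F, which is F_12 (\<Delta> (x) id)(F).\<close>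

lemma twist_mult_mult_left:
  assumes d: "\<alpha> \<in> dual smul" "\<beta> \<in> dual smul" "\<gamma> \<in> dual smul"
  shows "twist_mult F (twist_mult F \<alpha> \<beta>) \<gamma> 1 =
    ev (\<lambda>(a, b, c). \<alpha> a * \<beta> b * \<gamma> c) (rep (mult3 smul (leg12 smul F) (cop_id smul \<Delta> F)))"
proof -
  \<comment> \<open>Trilinearity is required twice: l in the entries of the right factor, where
    (\<Delta> (x) id)(F) is expanded, and r in those of the left factor, where F_12 is.\<close>
  have l: "trilin (\<lambda>(a, b, c). \<alpha> (u * a) * \<beta> (v * b) * \<gamma> (w * c))" for u v w
    using d by (intro trilin_tensor dual_mult_left)
  have r: "trilin (\<lambda>(a, b, c). ev (\<lambda>(a', b', c'). \<alpha> (a * a') * \<beta> (b * b') * \<gamma> (c * c')) q)" for q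
    using d unfolding trilin_def case_prod_unfold fst_conv snd_conv
    by (intro conjI allI dual_ev) (auto simp: dual_iff algebra_simps scale_mult_left)
  have "ev (\<lambda>(a, b, c). \<alpha> a * \<beta> b * \<gamma> c) (rep (mult3 smul (leg12 smul F) (cop_id smul \<Delta> F))) =
      ev (\<lambda>(a, b, c). ev (\<lambda>(a', b', c'). \<alpha> (a * a') * \<beta> (b * b') * \<gamma> (c * c'))
        (rep (cop_id smul \<Delta> F))) (rep (leg12 smul F))"
    by (simp add: ev_mult3[OF trilin_tensor[OF d]])
  also have "\<dots> = ev (\<lambda>(u, v). ev (\<lambda>(a, b, c). \<alpha> (u * a) * \<beta> (v * b) * \<gamma> (1 * c))
      (rep (cop_id smul \<Delta> F))) (rep F)"
    unfolding ev_leg12[OF r] by simp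
  also have "\<dots> =
      ev (\<lambda>(u, v). ev (\<lambda>(x, y). ev (\<lambda>(a, b). \<alpha> (u * a) * \<beta> (v * b) * \<gamma> (1 * y))
        (rep (\<Delta> x))) (rep F)) (rep F)"
    unfolding ev_cop_id[OF l] by (simp add: mult.assoc)
  \<comment> \<open>The sum over the copy of F in F_12 moves inside, so that the outer copy is the
    one whose first leg is comultiplied.\<close>
  also have "\<dots> = ev (\<lambda>(x, y). ev (\<lambda>(u, v). ev (\<lambda>(a, b). \<alpha> (u * a) * \<beta> (v * b))
      (rep (\<Delta> x))) (rep F) * \<gamma> y) (rep F)"
    unfolding case_prod_unfold by (subst ev_swap) (simp add: ev_mult_right)
  also have "\<dots> = twist_mult F (twist_mult F \<alpha> \<beta>) \<gamma> 1"
    unfolding twist_mult_one[OF twist_mult_dual[OF d(1,2)] d(3)] pair2_def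
    by (simp add: twist_mult_eq d)
  finally show ?thesis ..
qed

lemma twist_mult_mult_right:
  assumes d: "\<alpha> \<in> dual smul" "\<beta> \<in> dual smul" "\<gamma> \<in> dual smul"
  shows "twist_mult F \<alpha> (twist_mult F \<beta> \<gamma>) 1 =
    ev (\<lambda>(a, b, c). \<alpha> a * \<beta> b * \<gamma> c) (rep (mult3 smul (leg23 smul F) (id_cop smul \<Delta> F)))"
proof -
  have l: "trilin (\<lambda>(a, b, c). \<alpha> (u * a) * \<beta> (v * b) * \<gamma> (w * c))" for u v w
    using d by (intro trilin_tensor dual_mult_left)
  have r: "trilin (\<lambda>(a, b, c). ev (\<lambda>(a', b', c'). \<alpha> (a * a') * \<beta> (b * b') * \<gamma> (c * c')) q)" for q
    using d unfolding trilin_def case_prod_unfold fst_conv snd_conv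
    by (intro conjI allI dual_ev) (auto simp: dual_iff algebra_simps scale_mult_left)
  have "ev (\<lambda>(a, b, c). \<alpha> a * \<beta> b * \<gamma> c) (rep (mult3 smul (leg23 smul F) (id_cop smul \<Delta> F))) =
      ev (\<lambda>(a, b, c). ev (\<lambda>(a', b', c'). \<alpha> (a * a') * \<beta> (b * b') * \<gamma> (c * c'))
        (rep (id_cop smul \<Delta> F))) (rep (leg23 smul F))"
    by (simp add: ev_mult3[OF trilin_tensor[OF d]])
  also have "\<dots> = ev (\<lambda>(u, v). ev (\<lambda>(a, b, c). \<alpha> (1 * a) * \<beta> (u * b) * \<gamma> (v * c))
      (rep (id_cop smul \<Delta> F))) (rep F)"
    unfolding ev_leg23[OF r] by simp
  also have "\<dots> =
      ev (\<lambda>(u, v). ev (\<lambda>(x, y). ev (\<lambda>(a, b). \<alpha> (1 * x) * (\<beta> (u * a) * \<gamma> (v * b)))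
        (rep (\<Delta> y))) (rep F)) (rep F)"
    unfolding ev_id_cop[OF l] by (simp add: mult.assoc)
  also have "\<dots> = ev (\<lambda>(x, y). \<alpha> x * ev (\<lambda>(u, v). ev (\<lambda>(a, b). \<beta> (u * a) * \<gamma> (v * b))
        (rep (\<Delta> y))) (rep F)) (rep F)"
    unfolding case_prod_unfold by (subst ev_swap) (simp add: ev_mult_left)
  also have "\<dots> = twist_mult F \<alpha> (twist_mult F \<beta> \<gamma>) 1"
    unfolding twist_mult_one[OF d(1) twist_mult_dual[OF d(2,3)]] pair2_def
    by (simp add: twist_mult_eq d)
  finally show ?thesis ..
qed

lemma cocycle_iff_assoc_at_one:
  "mult3 smul (leg12 smul F) (cop_id smul \<Delta> F) = mult3 smul (leg23 smul F) (id_cop smul \<Delta> F) \<longleftrightarrow>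
   (\<forall>\<alpha>\<in>dual smul. \<forall>\<beta>\<in>dual smul. \<forall>\<gamma>\<in>dual smul.
      twist_mult F (twist_mult F \<alpha> \<beta>) \<gamma> 1 = twist_mult F \<alpha> (twist_mult F \<beta> \<gamma>) 1)"
  (is "?L = ?R \<longleftrightarrow> ?A")
proof
  assume A: ?A
  show "?L = ?R"
    \<comment> \<open>\<open>class3_eqI\<close> compares formal sums, so the two products are opened
      down to the sums whose classes they are; \<open>ev_class3\<close> then leads back to the
      chosen representatives.\<close>
    unfolding mult3_def
  proof (rule class3_eqI)
    fix \<alpha> \<beta> \<gamma> assume d: "\<alpha> \<in> dual smul" "\<beta> \<in> dual smul" "\<gamma> \<in> dual smul"
    have "ev (\<lambda>(a, b, c). \<alpha> a * \<beta> b * \<gamma> c) (rep ?L) = ev (\<lambda>(a, b, c). \<alpha> a * \<beta> b * \<gamma> c) (rep ?R)"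
      using A d by (simp flip: twist_mult_mult_left twist_mult_mult_right)
    then show "ev (\<lambda>(a, b, c). \<alpha> a * \<beta> b * \<gamma> c) (lin_ext fscale (\<lambda>(a, b, c). lin_ext fscale
        (\<lambda>(a', b', c'). gen (a * a', b * b', c * c')) (rep (cop_id smul \<Delta> F))) (rep (leg12 smul F))) =
      ev (\<lambda>(a, b, c). \<alpha> a * \<beta> b * \<gamma> c) (lin_ext fscale (\<lambda>(a, b, c). lin_ext fscale
        (\<lambda>(a', b', c'). gen (a * a', b * b', c * c')) (rep (id_cop smul \<Delta> F))) (rep (leg23 smul F)))"
      unfolding mult3_def ev_class3[OF trilin_tensor[OF d]] .
  qed
qed (simp add: twist_mult_mult_left twist_mult_mult_right)

text \<open>Because the first leg of (\<epsilon> (x) id)(F) consists of multiples of 1, pairing it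
  with \<alpha> (x) \<beta> gives \<open>\<alpha> 1\<close> times the value at 1 of the product of
  \<epsilon> and \<beta>.\<close>

lemma eps_id_iff:
  "eps_id smul \<epsilon> F = class2 smul (gen (1, 1)) \<longleftrightarrow> (\<forall>f\<in>dual smul. twist_mult F \<epsilon> f 1 = f 1)"
proof -
  let ?p = "lin_ext fscale (\<lambda>(a, b). gen (\<epsilon> a *s 1, b)) (rep F)"
  have ev: "ev (\<lambda>(a, b). \<alpha> a * \<beta> b) ?p = \<alpha> 1 * twist_mult F \<epsilon> \<beta> 1"
    if "\<alpha> \<in> dual smul" "\<beta> \<in> dual smul" for \<alpha> \<beta>
  proof -
    have \<alpha>: "\<alpha> (c *s 1) = \<alpha> 1 * c" for c
      using that(1) by (simp add: dual_iff mult.commute)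
    show ?thesis
      using that by (simp add: twist_mult_one counit_dual pair2_def ev_lin_ext case_prod_unfold \<alpha>
          mult.assoc ev_mult_left)
  qed
  show ?thesis
  proof
    assume eq: "eps_id smul \<epsilon> F = class2 smul (gen (1, 1))"
    show "\<forall>f\<in>dual smul. twist_mult F \<epsilon> f 1 = f 1"
    proof
      fix f assume f: "f \<in> dual smul"
      \<comment> \<open>The first functional is \<epsilon> because its value at 1 is 1, so the extra
        factor disappears.\<close>
      have "pair2 \<epsilon> f (class2 smul ?p) = pair2 \<epsilon> f (class2 smul (gen (1, 1)))"
        using eq by (simp add: eps_id_def)
      then show "twist_mult F \<epsilon> f 1 = f 1"
        unfolding pair2_class2[OF counit_dual f] ev[OF counit_dual f] by (simp add: counit_one)
    qed
  next
    assume "\<forall>f\<in>dual smul. twist_mult F \<epsilon> f 1 = f 1"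
    then show "eps_id smul \<epsilon> F = class2 smul (gen (1, 1))"
      unfolding eps_id_def by (intro class2_eqI) (simp add: ev)
  qed
qed

lemma id_eps_iff:
  "id_eps smul \<epsilon> F = class2 smul (gen (1, 1)) \<longleftrightarrow> (\<forall>f\<in>dual smul. twist_mult F f \<epsilon> 1 = f 1)"
proof -
  let ?p = "lin_ext fscale (\<lambda>(a, b). gen (a, \<epsilon> b *s 1)) (rep F)"
  have ev: "ev (\<lambda>(a, b). \<alpha> a * \<beta> b) ?p = twist_mult F \<alpha> \<epsilon> 1 * \<beta> 1"
    if "\<alpha> \<in> dual smul" "\<beta> \<in> dual smul" for \<alpha> \<beta>
  proof -
    have \<beta>: "\<beta> (c *s 1) = c * \<beta> 1" for c
      using that(2) by (simp add: dual_iff)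
    show ?thesis
      using that by (simp add: twist_mult_one counit_dual pair2_def ev_lin_ext case_prod_unfold \<beta>
          ev_mult_right flip: mult.assoc)
  qed
  show ?thesis
  proof
    assume eq: "id_eps smul \<epsilon> F = class2 smul (gen (1, 1))"
    show "\<forall>f\<in>dual smul. twist_mult F f \<epsilon> 1 = f 1"
    proof
      fix f assume f: "f \<in> dual smul"
      have "pair2 f \<epsilon> (class2 smul ?p) = pair2 f \<epsilon> (class2 smul (gen (1, 1)))"
        using eq by (simp add: id_eps_def)
      then show "twist_mult F f \<epsilon> 1 = f 1"
        unfolding pair2_class2[OF f counit_dual] ev[OF f counit_dual] by (simp add: counit_one)
    qed
  next
    assume "\<forall>f\<in>dual smul. twist_mult F f \<epsilon> 1 = f 1"
    then show "id_eps smul \<epsilon> F = class2 smul (gen (1, 1))"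
      unfolding id_eps_def by (intro class2_eqI) (simp add: ev)
  qed
qed

section \<open>The correspondence\<close>

lemma module_algebra_iff:
  "module_algebra smul \<Delta> m \<longleftrightarrow> m \<in> dual smul \<rightarrow>\<^sub>E (dual smul \<rightarrow>\<^sub>E dual smul) \<and> equivariant_mult m \<and>
     (\<forall>\<alpha>\<in>dual smul. \<forall>\<beta>\<in>dual smul. \<forall>\<gamma>\<in>dual smul. m (m \<alpha> \<beta>) \<gamma> = m \<alpha> (m \<beta> \<gamma>))"
proof -
  have into: "\<forall>\<alpha>\<in>dual smul. \<forall>\<beta>\<in>dual smul. m \<alpha> \<beta> \<in> dual smul"
    if "m \<in> dual smul \<rightarrow>\<^sub>E (dual smul \<rightarrow>\<^sub>E dual smul)"
    using PiE_mem[OF PiE_mem[OF that]] by blast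
  show ?thesis
    unfolding module_algebra_def equivariant_mult_def
    by (rule iffI; elim conjE; intro conjI; (assumption | erule into))
qed

text \<open>Each clause of the twist definition is a law of the multiplication at 1, and
  equivariance spreads that law to all of H. As an equivalence it serves both to place the image of
  a twist and to recognise a representing tensor as a twist.\<close>

lemma twist_element_iff:
  "twist_element smul \<Delta> \<epsilon> F \<longleftrightarrow>
    F \<in> tensor2 smul \<and> unital_module_algebra smul \<Delta> \<epsilon> (twist_mult F)"
proof -
  note eq = equivariant_twist_mult[of F]
  have assoc: "(\<forall>\<alpha>\<in>dual smul. \<forall>\<beta>\<in>dual smul. \<forall>\<gamma>\<in>dual smul.
        twist_mult F (twist_mult F \<alpha> \<beta>) \<gamma> 1 = twist_mult F \<alpha> (twist_mult F \<beta> \<gamma>) 1) \<longleftrightarrow>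
      (\<forall>\<alpha>\<in>dual smul. \<forall>\<beta>\<in>dual smul. \<forall>\<gamma>\<in>dual smul.
        twist_mult F (twist_mult F \<alpha> \<beta>) \<gamma> = twist_mult F \<alpha> (twist_mult F \<beta> \<gamma>))"
    by (intro iffI ballI mult_assocI[OF eq]) simp_all
  have unit_left: "(\<forall>f\<in>dual smul. twist_mult F \<epsilon> f 1 = f 1) \<longleftrightarrow> (\<forall>f\<in>dual smul. twist_mult F \<epsilon> f = f)"
    by (intro iffI ballI mult_unit_leftI[OF eq]) simp_all
  have unit_right: "(\<forall>f\<in>dual smul. twist_mult F f \<epsilon> 1 = f 1) \<longleftrightarrow> (\<forall>f\<in>dual smul. twist_mult F f \<epsilon> = f)"
    by (intro iffI ballI mult_unit_rightI[OF eq]) simp_all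
  have "twist_element smul \<Delta> \<epsilon> F \<longleftrightarrow> F \<in> tensor2 smul \<and>
      (\<forall>\<alpha>\<in>dual smul. \<forall>\<beta>\<in>dual smul. \<forall>\<gamma>\<in>dual smul.
        twist_mult F (twist_mult F \<alpha> \<beta>) \<gamma> 1 = twist_mult F \<alpha> (twist_mult F \<beta> \<gamma>) 1) \<and>
      (\<forall>f\<in>dual smul. twist_mult F \<epsilon> f 1 = f 1) \<and> (\<forall>f\<in>dual smul. twist_mult F f \<epsilon> 1 = f 1)"
    by (simp only: twist_element_def cocycle_iff_assoc_at_one eps_id_iff id_eps_iff)
  also have "\<dots> \<longleftrightarrow> F \<in> tensor2 smul \<and>
      (\<forall>\<alpha>\<in>dual smul. \<forall>\<beta>\<in>dual smul. \<forall>\<gamma>\<in>dual smul.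
        twist_mult F (twist_mult F \<alpha> \<beta>) \<gamma> = twist_mult F \<alpha> (twist_mult F \<beta> \<gamma>)) \<and>
      (\<forall>f\<in>dual smul. twist_mult F \<epsilon> f = f) \<and> (\<forall>f\<in>dual smul. twist_mult F f \<epsilon> = f)"
    unfolding assoc unit_left unit_right ..
  also have "\<dots> \<longleftrightarrow> F \<in> tensor2 smul \<and> unital_module_algebra smul \<Delta> \<epsilon> (twist_mult F)"
    by (simp only: unital_module_algebra_def module_algebra_iff eq twist_mult_PiE
        ball_conj_distrib simp_thms conj_assoc)
  finally show ?thesis .
qed

lemma continuous_twist_mult:
  "continuous_map (prod_topology (weak_star smul) (weak_star smul)) (weak_star smul)
    (\<lambda>(\<alpha>, \<beta>). twist_mult F \<alpha> \<beta>)"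
  by (rule continuous_map_weak_star_bilinearI[where T = "\<lambda>a. mult2 smul F (\<Delta> a)"])
    (simp_all add: twist_mult_dual, simp add: twist_mult_def)

lemma bij_betw_twist_mult:
  "bij_betw twist_mult {F. twist_element smul \<Delta> \<epsilon> F}
    {m. unital_module_algebra smul \<Delta> \<epsilon> m \<and>
        continuous_map (prod_topology (weak_star smul) (weak_star smul)) (weak_star smul)
          (\<lambda>(\<alpha>, \<beta>). m \<alpha> \<beta>)}"
proof (rule bij_betw_imageI)
  show "inj_on twist_mult {F. twist_element smul \<Delta> \<epsilon> F}"
  proof (rule inj_onI)
    fix F G assume "F \<in> {F. twist_element smul \<Delta> \<epsilon> F}" "G \<in> {F. twist_element smul \<Delta> \<epsilon> F}"
      and eq: "twist_mult F = twist_mult G"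
    then have "F \<in> tensor2 smul" "G \<in> tensor2 smul" by (simp_all add: twist_element_iff)
    then show "F = G"
      by (rule tensor2_eqI) (metis twist_mult_one eq)
  qed
  show "twist_mult ` {F. twist_element smul \<Delta> \<epsilon> F} =
    {m. unital_module_algebra smul \<Delta> \<epsilon> m \<and>
        continuous_map (prod_topology (weak_star smul) (weak_star smul)) (weak_star smul)
          (\<lambda>(\<alpha>, \<beta>). m \<alpha> \<beta>)}" (is "_ = ?M")
  proof (intro equalityI subsetI)
    fix m assume "m \<in> ?M"
    then have m: "unital_module_algebra smul \<Delta> \<epsilon> m"
      and cont: "continuous_map (prod_topology (weak_star smul) (weak_star smul)) (weak_star smul)
          (\<lambda>(\<alpha>, \<beta>). m \<alpha> \<beta>)" by simp_all
    have PiE: "m \<in> dual smul \<rightarrow>\<^sub>E (dual smul \<rightarrow>\<^sub>E dual smul)" and eq: "equivariant_mult m"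
      using m by (simp_all add: unital_module_algebra_def module_algebra_iff)
    obtain F where F: "F \<in> tensor2 smul"
      and 1: "\<forall>\<alpha>\<in>dual smul. \<forall>\<beta>\<in>dual smul. m \<alpha> \<beta> 1 = pair2 \<alpha> \<beta> F"
      using exists_tensor_of_continuous[OF eq cont] by (elim bexE)
    \<comment> \<open>F was built from the values at 1 only. Once m is known to be its
      multiplication, the laws of m make F a twist.\<close>
    have "m = twist_mult F"
      using 1 by (intro equivariant_eq_twist_mult[OF eq PiE]) simp
    with m F show "m \<in> twist_mult ` {F. twist_element smul \<Delta> \<epsilon> F}"
      by (auto simp: twist_element_iff)
  qed (use continuous_twist_mult in \<open>auto simp: twist_element_iff\<close>)
qed

text \<open>The weak-* topology and its square are discrete, so it is enough that m maps into the
  dual.\<close>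

lemma continuous_of_finite_dimensional:
  assumes "finite_dimensional_vector_space smul B" "unital_module_algebra smul \<Delta> \<epsilon> m"
  shows "continuous_map (prod_topology (weak_star smul) (weak_star smul)) (weak_star smul)
    (\<lambda>(\<alpha>, \<beta>). m \<alpha> \<beta>)"
proof -
  have "equivariant_mult m"
    using assms(2) by (simp add: unital_module_algebra_def module_algebra_iff)
  then show ?thesis
    using mult_dual
    by (auto simp: weak_star_finite_dimensional[OF assms(1)] simp flip: prod_topology_discrete_topology)
qed

end

theorem proposition2p2:
  fixes smul :: "'k::field \<Rightarrow> 'a::ring_1 \<Rightarrow> 'a"
    and \<Delta> :: "'a \<Rightarrow> ('a \<times> 'a \<Rightarrow>\<^sub>0 'k) set"
    and \<epsilon> :: "'a \<Rightarrow> 'k"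
    and S :: "'a \<Rightarrow> 'a"
  assumes "hopf_algebra smul \<Delta> \<epsilon> S"
  shows "bij_betw
      (\<lambda>F. \<lambda>\<alpha>\<in>dual smul. \<lambda>\<beta>\<in>dual smul. \<lambda>a. pair2 \<alpha> \<beta> (mult2 smul F (\<Delta> a)))
      {F. twist_element smul \<Delta> \<epsilon> F}
      {m. unital_module_algebra smul \<Delta> \<epsilon> m \<and>
          continuous_map (prod_topology (weak_star smul) (weak_star smul)) (weak_star smul)
            (\<lambda>(\<alpha>, \<beta>). m \<alpha> \<beta>)}
    \<and> ((\<exists>B. finite_dimensional_vector_space smul B) \<longrightarrow>
    bij_betw
      (\<lambda>F. \<lambda>\<alpha>\<in>dual smul. \<lambda>\<beta>\<in>dual smul. \<lambda>a. pair2 \<alpha> \<beta> (mult2 smul F (\<Delta> a)))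
      {F. twist_element smul \<Delta> \<epsilon> F}
      {m. unital_module_algebra smul \<Delta> \<epsilon> m})"
proof -
  interpret hopf_algebra smul \<Delta> \<epsilon> S by fact
  note bij = bij_betw_twist_mult[unfolded twist_mult_def[abs_def]]
  show ?thesis
  proof (intro conjI impI bij, elim exE)
    fix B assume "finite_dimensional_vector_space smul B"
    then have "{m. unital_module_algebra smul \<Delta> \<epsilon> m} =
      {m. unital_module_algebra smul \<Delta> \<epsilon> m \<and>
          continuous_map (prod_topology (weak_star smul) (weak_star smul)) (weak_star smul)
            (\<lambda>(\<alpha>, \<beta>). m \<alpha> \<beta>)}"
      using continuous_of_finite_dimensional by blast
    with bij show "bij_betw
      (\<lambda>F. \<lambda>\<alpha>\<in>dual smul. \<lambda>\<beta>\<in>dual smul. \<lambda>a. pair2 \<alpha> \<beta> (mult2 smul F (\<Delta> a)))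
      {F. twist_element smul \<Delta> \<epsilon> F} {m. unital_module_algebra smul \<Delta> \<epsilon> m}"
      by simp
  qed
qed

end
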